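(* Let $\mathscr G$ be an ample groupoid and let $R$ be a unital ring (not necessarily commutative). Then the groupoid algebra $R\mathscr G$ is von Neumann regular if and only if all of the following hold: (1) $R$ is von Neumann regular; (2) $\mathscr G$ is a directed union of quasi-compact open subgroupoids; (3) the order of each finite subgroup of an isotropy group of $\mathscr G$ is invertible in $R$.
   Context: A ring $A$ (not necessarily unital) is von Neumann regular if for every $a\in A$ there is $b\in A$ with $aba=a$. A space is quasi-compact if every open cover has a finite subcover (no Hausdorff assumption); compact means quasi-compact and Hausdorff. A topological groupoid is a nonempty groupoid $\mathscr G$ with a locally compact topology (every point has a compact, in particular Hausdorff, neighborhood) such that composition and inversion are continuous; $\mathscr G$ need not be Hausdorff, but the unit space $\mathscr G^{(0)}$ is assumed Hausdorff in the relative topology. The source and range maps are $\boldsymbol s,\boldsymbol r\colon\mathscr G\to\mathscr G^{(0)}$; the product $\alpha\beta$ is defined iff $\boldsymbol s(\alpha)=\boldsymbol r(\beta)$. $\mathscr G$ is étale if $\boldsymbol r$ (equivalently $\boldsymbol s$) is a local homeomorphism, and ample if it is étale and $\mathscr G^{(0)}$ is a locally compact Hausdorff space with a basis of compact open sets. A bisection is an open set $U\subseteq\mathscr G$ such that $\boldsymbol r|_U$ and $\boldsymbol s|_U$ are homeomorphisms onto open subsets of $\mathscr G^{(0)}$; $\Gamma_c(\mathscr G)$ is the set of compact open bisections. The isotropy group at $x\in\mathscr G^{(0)}$ is $\mathscr G_x^x=\{\gamma\in\mathscr G\mid \boldsymbol s(\gamma)=x=\boldsymbol r(\gamma)\}$.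 The algebra $R\mathscr G$ is the left $R$-submodule of $R^{\mathscr G}$ spanned by the characteristic functions $1_U$, $U\in\Gamma_c(\mathscr G)$, with convolution product $f*g(\gamma)=\sum_{\alpha\beta=\gamma}f(\alpha)g(\beta)$. A directed union is the union of a family of subgroupoids that is directed under inclusion. *)

theory Defs
  imports "HOL-Analysis.Analysis" "HOL-Algebra.Group"
begin

text \<open>
  The arrows of a groupoid form a whole type, and a unit is identified with its identity arrow.
  Composition is a total function whose value matters only at pairs with
  \<open>src G a = rng G b\<close>.
\<close>

record 'g groupoid_ops =
  src :: "'g \<Rightarrow> 'g"
  rng :: "'g \<Rightarrow> 'g"
  cmp :: "'g \<Rightarrow> 'g \<Rightarrow> 'g"
  ginv :: "'g \<Rightarrow> 'g"

definition units_of_groupoid :: "'g groupoid_ops \<Rightarrow> 'g set" where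
  "units_of_groupoid G = range (src G)"

definition composable :: "'g groupoid_ops \<Rightarrow> ('g \<times> 'g) set" where
  "composable G = {(a, b). src G a = rng G b}"

locale groupoid =
  fixes G :: "'g groupoid_ops"
  assumes src_src: "src G (src G a) = src G a"
    and rng_src: "rng G (src G a) = src G a"
    and src_rng: "src G (rng G a) = rng G a"
    and rng_rng: "rng G (rng G a) = rng G a"
    and src_cmp: "src G a = rng G b \<Longrightarrow> src G (cmp G a b) = src G b"
    and rng_cmp: "src G a = rng G b \<Longrightarrow> rng G (cmp G a b) = rng G a"
    and cmp_assoc: "src G a = rng G b \<Longrightarrow> src G b = rng G c \<Longrightarrow>
      cmp G (cmp G a b) c = cmp G a (cmp G b c)"
    and cmp_rng_left: "cmp G (rng G a) a = a"
    and cmp_src_right: "cmp G a (src G a) = a"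
    and src_ginv: "src G (ginv G a) = rng G a"
    and rng_ginv: "rng G (ginv G a) = src G a"
    and cmp_ginv_right: "cmp G a (ginv G a) = rng G a"
    and cmp_ginv_left: "cmp G (ginv G a) a = src G a"

text \<open>
  The constant \<^const>\<open>compact\<close> asserts only the finite subcover property (quasi-compactness);
  its type class does not provide the Hausdorff property.
\<close>

definition compact_hausdorff :: "'g::topological_space set \<Rightarrow> bool" where
  "compact_hausdorff K \<longleftrightarrow> compact K \<and> Hausdorff_space (top_of_set K)"

locale topological_groupoid = groupoid G for G :: "'g::topological_space groupoid_ops" +
  assumes locally_compact:
      "\<And>x::'g. \<exists>U K. open U \<and> x \<in> U \<and> U \<subseteq> K \<and> compact_hausdorff K"
    and continuous_cmp: "continuous_on (composable G) (\<lambda>(a, b). cmp G a b)"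
    and continuous_ginv: "continuous_on UNIV (ginv G)"
    and units_Hausdorff: "Hausdorff_space (top_of_set (units_of_groupoid G))"

definition homeo_onto_open_units ::
    "'g::topological_space groupoid_ops \<Rightarrow> ('g \<Rightarrow> 'g) \<Rightarrow> 'g set \<Rightarrow> bool" where
  "homeo_onto_open_units G f U \<longleftrightarrow>
     openin (top_of_set (units_of_groupoid G)) (f ` U) \<and> (\<exists>g. homeomorphism U (f ` U) f g)"

locale etale_groupoid = topological_groupoid +
  assumes rng_local_homeo: "\<And>x. \<exists>U. open U \<and> x \<in> U \<and> homeo_onto_open_units G (rng G) U"

locale ample_groupoid = etale_groupoid +
  assumes units_locally_compact: "locally_compact_space (top_of_set (units_of_groupoid G))"
    and units_compact_open_basis:
      "\<And>W x. openin (top_of_set (units_of_groupoid G)) W \<Longrightarrow> x \<in> W \<Longrightarrow>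
         \<exists>K. openin (top_of_set (units_of_groupoid G)) K \<and> compact_hausdorff K \<and> x \<in> K \<and> K \<subseteq> W"

definition bisection :: "'g::topological_space groupoid_ops \<Rightarrow> 'g set \<Rightarrow> bool" where
  "bisection G U \<longleftrightarrow>
     open U \<and> homeo_onto_open_units G (rng G) U \<and> homeo_onto_open_units G (src G) U"

definition compact_bisections :: "'g::topological_space groupoid_ops \<Rightarrow> 'g set set" where
  "compact_bisections G = {U. bisection G U \<and> compact_hausdorff U}"

definition groupoid_algebra ::
    "'g::topological_space groupoid_ops \<Rightarrow> ('g \<Rightarrow> 'r::ring_1) set" where
  "groupoid_algebra G =
     {f. \<exists>\<U> c. finite \<U> \<and> \<U> \<subseteq> compact_bisections G \<and>
            f = (\<lambda>x. \<Sum>U\<in>\<U>. c U * indicator U x)}"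

text \<open>
  For an ample groupoid and functions in the groupoid algebra only finitely many factorizations
  of an arrow contribute a nonzero summand; the index set is cut down to these because
  \<^const>\<open>sum\<close> is zero on infinite sets.
\<close>

definition convolution ::
    "'g groupoid_ops \<Rightarrow> ('g \<Rightarrow> 'r::ring_1) \<Rightarrow> ('g \<Rightarrow> 'r) \<Rightarrow> 'g \<Rightarrow> 'r" where
  "convolution G f h x =
     (\<Sum>(a, b) | (a, b) \<in> composable G \<and> cmp G a b = x \<and> f a * h b \<noteq> 0. f a * h b)"

definition von_neumann_regular :: "'a set \<Rightarrow> ('a \<Rightarrow> 'a \<Rightarrow> 'a) \<Rightarrow> bool" where
  "von_neumann_regular A mul \<longleftrightarrow> (\<forall>a\<in>A. \<exists>b\<in>A. mul (mul a b) a = a)"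

definition subgroupoid :: "'g groupoid_ops \<Rightarrow> 'g set \<Rightarrow> bool" where
  "subgroupoid G H \<longleftrightarrow> H \<noteq> {} \<and> (\<forall>a\<in>H. ginv G a \<in> H) \<and>
     (\<forall>a\<in>H. \<forall>b\<in>H. src G a = rng G b \<longrightarrow> cmp G a b \<in> H)"

definition directed_union_of :: "('g set \<Rightarrow> bool) \<Rightarrow> 'g set \<Rightarrow> bool" where
  "directed_union_of P X \<longleftrightarrow>
     (\<exists>\<D>. \<D> \<noteq> {} \<and> (\<forall>H\<in>\<D>. P H) \<and> (\<forall>H\<in>\<D>. \<forall>K\<in>\<D>. \<exists>L\<in>\<D>. H \<subseteq> L \<and> K \<subseteq> L) \<and> \<Union>\<D> = X)"

definition isotropy_group :: "'g groupoid_ops \<Rightarrow> 'g \<Rightarrow> 'g monoid" where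
  "isotropy_group G x =
     \<lparr>carrier = {a. src G a = x \<and> rng G a = x}, monoid.mult = cmp G, one = x\<rparr>"

definition ring_invertible :: "'r::ring_1 \<Rightarrow> bool" where
  "ring_invertible a \<longleftrightarrow> (\<exists>b. a * b = 1 \<and> b * a = 1)"

end

theory Submission
  imports Defs
begin

text \<open>
  Necessity.  Evaluating \<open>f b f = f\<close> at a unit for \<open>f = c 1\<^sub>U\<close> gives regularity of the coefficients, and
  evaluating it at the identity \<open>x\<close> of a finite isotropy subgroup \<open>H\<close>, for \<open>f\<close> a sum of bisections through
  the elements of \<open>H\<close>, gives \<open>1 = |H| (\<Sum>k\<in>H. b k)\<close>.  For compact generation, cover a compact set by
  bisections \<open>U\<close>.  The finitely many elements \<open>1\<^sub>U - 1\<^sub>r\<^sub>(\<^sub>U\<^sub>)\<close> have a common right unit \<open>e\<close> in the left ideal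
  they generate, which is killed by the augmentation \<open>f \<mapsto> (x \<mapsto> \<Sum>r(a)=x. f a)\<close>.  Hence \<open>p = 1\<^sub>K - e\<close> is invariant
  under left translation by the \<open>U\<close> and nonzero over every unit of \<open>K\<close>; translating one point of its
  support bounds the number of words with a given source, so that words of bounded length already form
  a subgroupoid, which is quasi-compact.

  Sufficiency.  An element \<open>f\<close> lives on a quasi-compact open subgroupoid \<open>H\<close>, whose orbits are finite.  Over
  one orbit a quasi-inverse comes from a matrix ring over \<open>R\<close> by averaging over the isotropy group.  Elements
  of the algebra are determined near \<open>x\<close> by their values over \<open>x\<close>, so it remains a quasi-inverse over
  an \<open>H\<close>-invariant compact open neighbourhood of the orbit, and finitely many of these are glued.
\<close>

subsection \<open>Convolution of fibrewise finite functions\<close>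

context groupoid
begin

section \<open>Cancellation and inversion in a groupoid\<close>

lemma cmp_ginv_cancel_left: "src G a = rng G b \<Longrightarrow> cmp G (ginv G a) (cmp G a b) = b"
  by (metis cmp_assoc cmp_ginv_left cmp_rng_left src_ginv)

lemma ginv_ginv: "ginv G (ginv G a) = a"
  by (metis cmp_ginv_cancel_left cmp_ginv_left cmp_src_right rng_ginv src_ginv)

lemma cmp_ginv_cancel_left': "rng G a = rng G b \<Longrightarrow> cmp G a (cmp G (ginv G a) b) = b"
  by (metis cmp_ginv_cancel_left ginv_ginv src_ginv)

lemma cmp_ginv_cancel_right: "src G a = rng G b \<Longrightarrow> cmp G (cmp G a b) (ginv G b) = a"
  by (metis cmp_assoc cmp_ginv_right cmp_src_right rng_ginv)

lemma cmp_ginv_cancel_right': "src G a = src G b \<Longrightarrow> cmp G (cmp G a (ginv G b)) b = a"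
  by (metis cmp_ginv_cancel_right ginv_ginv rng_ginv)

lemma ginv_cmp: "src G a = rng G b \<Longrightarrow> ginv G (cmp G a b) = cmp G (ginv G b) (ginv G a)"
  by (smt (verit) cmp_assoc cmp_ginv_cancel_left cmp_ginv_cancel_right ginv_ginv rng_cmp
      rng_ginv src_cmp src_ginv)

lemma unit_iff: "x \<in> units_of_groupoid G \<longleftrightarrow> src G x = x"
  unfolding units_of_groupoid_def by (metis rangeE rangeI src_src)

lemma unit_iff': "x \<in> units_of_groupoid G \<longleftrightarrow> rng G x = x"
  using unit_iff by (metis rng_src src_rng)

lemma src_unit [simp]: "src G x \<in> units_of_groupoid G"
  by (simp add: unit_iff src_src)

lemma rng_unit [simp]: "rng G x \<in> units_of_groupoid G"
  by (simp add: unit_iff src_rng)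

lemma ginv_unit: "x \<in> units_of_groupoid G \<Longrightarrow> ginv G x = x"
  by (metis cmp_ginv_left cmp_rng_left ginv_ginv unit_iff rng_ginv unit_iff' cmp_src_right)

lemma cmp_unit_right: "src G a = x \<Longrightarrow> cmp G a x = a"
  using cmp_src_right by blast

lemma cmp_unit_left: "rng G a = x \<Longrightarrow> cmp G x a = a"
  using cmp_rng_left by blast

text \<open>As rewrite rules these bring composites of arrows to a normal form: right-associated,
  with inverses pushed inwards and adjacent inverse pairs cancelled.\<close>

lemmas gsimps = src_src rng_src src_rng rng_rng src_cmp rng_cmp cmp_unit_right cmp_unit_left
  src_ginv rng_ginv cmp_ginv_right cmp_ginv_left cmp_ginv_cancel_left cmp_ginv_cancel_left'
  cmp_ginv_cancel_right cmp_ginv_cancel_right' ginv_ginv ginv_cmp cmp_assoc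

section \<open>Convolution as a finite sum over one factor\<close>

text \<open>In a factorization of \<open>x\<close> the left factor \<open>a\<close> forces the right
  one to be \<open>cmp G (ginv G a) x\<close>. Allowing any finite \<open>A\<close> that contains
  the contributing arrows lets different convolutions be summed over a common index set.\<close>

lemma convolution_eq_left:
  assumes "finite A" and "\<And>a. a \<in> A \<Longrightarrow> rng G a = rng G x"
    and "\<And>a. rng G a = rng G x \<Longrightarrow> f a * h (cmp G (ginv G a) x) \<noteq> 0 \<Longrightarrow> a \<in> A"
  shows "convolution G f h x = (\<Sum>a\<in>A. f a * h (cmp G (ginv G a) x))"
proof -
  let ?A = "{a \<in> A. f a * h (cmp G (ginv G a) x) \<noteq> 0}"
  let ?j = "\<lambda>a. (a, cmp G (ginv G a) x)"
  have *: "{(a, b). (a, b) \<in> composable G \<and> cmp G a b = x \<and> f a * h b \<noteq> 0} = ?j ` ?A"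
  proof (intro equalityI subsetI)
    fix p assume "p \<in> {(a, b). (a, b) \<in> composable G \<and> cmp G a b = x \<and> f a * h b \<noteq> 0}"
    then obtain a b where p: "p = (a, b)" "src G a = rng G b" "cmp G a b = x" "f a * h b \<noteq> 0"
      by (auto simp: composable_def)
    then have "b = cmp G (ginv G a) x" "rng G a = rng G x" by (auto simp: gsimps)
    then show "p \<in> ?j ` ?A" using p assms(3)[of a] by auto
  next
    fix p assume "p \<in> ?j ` ?A"
    then obtain a where "a \<in> A" "f a * h (cmp G (ginv G a) x) \<noteq> 0" "p = ?j a" by blast
    then show "p \<in> {(a, b). (a, b) \<in> composable G \<and> cmp G a b = x \<and> f a * h b \<noteq> 0}"
      using assms(2)[of a] by (simp add: composable_def gsimps)
  qed
  have "convolution G f h x = (\<Sum>a\<in>?A. f a * h (cmp G (ginv G a) x))"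
    unfolding convolution_def * by (subst sum.reindex) (auto simp: inj_on_def)
  also have "\<dots> = (\<Sum>a\<in>A. f a * h (cmp G (ginv G a) x))"
    by (rule sum.mono_neutral_left) (use assms(1) in auto)
  finally show ?thesis .
qed

text \<open>A factorization is equally determined by its right factor, and
  \<open>b \<mapsto> cmp G x (ginv G b)\<close> carries this sum to the one over left
  factors.\<close>

lemma convolution_eq_right:
  assumes "finite B" and "\<And>b. b \<in> B \<Longrightarrow> src G b = src G x"
    and "\<And>b. src G b = src G x \<Longrightarrow> f (cmp G x (ginv G b)) * h b \<noteq> 0 \<Longrightarrow> b \<in> B"
  shows "convolution G f h x = (\<Sum>b\<in>B. f (cmp G x (ginv G b)) * h b)"
proof -
  let ?j = "\<lambda>b. cmp G x (ginv G b)"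
  have inj: "inj_on ?j B"
    by (rule inj_on_inverseI[of _ "\<lambda>a. cmp G (ginv G a) x"])
      (simp add: assms(2) gsimps)
  have "convolution G f h x = (\<Sum>a\<in>?j ` B. f a * h (cmp G (ginv G a) x))"
  proof (rule convolution_eq_left)
    fix a assume a: "rng G a = rng G x" "f a * h (cmp G (ginv G a) x) \<noteq> 0"
    then have "cmp G (ginv G a) x \<in> B" by (intro assms(3)) (auto simp: gsimps)
    moreover have "?j (cmp G (ginv G a) x) = a" using a by (simp add: gsimps)
    ultimately show "a \<in> ?j ` B" by (metis imageI)
  qed (use assms(1,2) in \<open>auto simp: gsimps\<close>)
  also have "\<dots> = (\<Sum>b\<in>B. f (cmp G x (ginv G b)) * h b)"
    by (subst sum.reindex[OF inj]) (auto intro!: sum.cong simp: assms(2) gsimps)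
  finally show ?thesis .
qed

text \<open>Finite range fibres already make the sums over left factors finite, so associativity and
  distributivity can be proved for this class without any topology.\<close>

definition rng_finite :: "('g \<Rightarrow> 'r::ring_1) \<Rightarrow> bool" where
  "rng_finite f \<longleftrightarrow> (\<forall>x. finite {a. rng G a = x \<and> f a \<noteq> 0})"

lemma convolution_rng_finite:
  "rng_finite f \<Longrightarrow> convolution G f h x =
    (\<Sum>a | rng G a = rng G x \<and> f a \<noteq> 0. f a * h (cmp G (ginv G a) x))"
  by (rule convolution_eq_left) (auto simp: rng_finite_def)

lemma rng_finite_zero: "rng_finite (\<lambda>_. 0)"
  by (simp add: rng_finite_def)

lemma rng_finite_add:
  assumes "rng_finite f" "rng_finite h" shows "rng_finite (\<lambda>x. f x + h x)"
  unfolding rng_finite_def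
proof
  fix x
  have "{a. rng G a = x \<and> f a + h a \<noteq> 0} \<subseteq>
      {a. rng G a = x \<and> f a \<noteq> 0} \<union> {a. rng G a = x \<and> h a \<noteq> 0}" by auto
  then show "finite {a. rng G a = x \<and> f a + h a \<noteq> 0}"
    using assms unfolding rng_finite_def by (meson finite_UnI finite_subset)
qed

lemma rng_finite_uminus: "rng_finite f \<Longrightarrow> rng_finite (\<lambda>x. - f x)"
  by (simp add: rng_finite_def)

lemma rng_finite_diff:
  assumes "rng_finite f" "rng_finite h" shows "rng_finite (\<lambda>x. f x - h x)"
  using rng_finite_add[OF assms(1) rng_finite_uminus[OF assms(2)]] by simp

lemma rng_finite_indicator:
  assumes "inj_on (rng G) U" shows "rng_finite (\<lambda>x. c * indicator U x)"
  unfolding rng_finite_def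
proof
  fix x
  have "{a \<in> U. rng G a = x} \<subseteq> {THE a. a \<in> U \<and> rng G a = x}"
  proof clarify
    fix a assume "a \<in> U" "x = rng G a"
    then show "a = (THE b. b \<in> U \<and> rng G b = rng G a)"
      by (intro the_equality[symmetric]) (use assms in \<open>auto dest: inj_onD\<close>)
  qed
  moreover have "{a. rng G a = x \<and> c * indicator U a \<noteq> 0} \<subseteq> {a \<in> U. rng G a = x}"
    by (auto simp: indicator_def split: if_splits)
  ultimately show "finite {a. rng G a = x \<and> c * indicator U a \<noteq> 0}"
    by (meson finite.simps finite_subset)
qed

text \<open>The finite set \<open>C\<close> of products of arrows supporting \<open>f\<close> and
  \<open>g\<close> contains the support of the inner convolution over the range of \<open>x\<close>.
  Both sides then become one double sum over \<open>?A\<close> and \<open>C\<close>; on the right,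
  \<open>b\<close> is replaced by \<open>c = a b\<close>.\<close>

lemma convolution_assoc:
  assumes f: "rng_finite f" and g: "rng_finite g"
  shows "convolution G (convolution G f g) h = convolution G f (convolution G g h)"
proof
  fix x
  let ?A = "{a. rng G a = rng G x \<and> f a \<noteq> 0}"
  define C where "C = (\<Union>a\<in>?A. cmp G a ` {b. rng G b = src G a \<and> g b \<noteq> 0})"
  have fA: "finite ?A" and fC: "finite C" using f g by (auto simp: rng_finite_def C_def)
  have rC: "rng G c = rng G x" if "c \<in> C" for c using that by (auto simp: gsimps C_def)
  have sub: "c \<in> C" if c: "rng G c = rng G x" "convolution G f g c \<noteq> 0" for c
  proof -
    from c obtain a where a: "rng G a = rng G c" "f a * g (cmp G (ginv G a) c) \<noteq> 0"
      unfolding convolution_rng_finite[OF f] by (auto elim: sum.not_neutral_contains_not_neutral)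
    then have "f a \<noteq> 0" "g (cmp G (ginv G a) c) \<noteq> 0" by auto
    then show ?thesis unfolding C_def
      using a(1) c(1) by (intro UN_I[of a] image_eqI[of _ _ "cmp G (ginv G a) c"]) (auto simp: gsimps)
  qed
  have "convolution G (convolution G f g) h x =
      (\<Sum>c\<in>C. convolution G f g c * h (cmp G (ginv G c) x))"
  proof (rule convolution_eq_left[OF fC rC])
    fix c assume c: "rng G c = rng G x" "convolution G f g c * h (cmp G (ginv G c) x) \<noteq> 0"
    then have "convolution G f g c \<noteq> 0" by (metis mult_zero_left)
    with c(1) show "c \<in> C" by (rule sub)
  qed
  also have "\<dots> = (\<Sum>c\<in>C. (\<Sum>a\<in>?A. f a * g (cmp G (ginv G a) c)) * h (cmp G (ginv G c) x))"
    using rC by (intro sum.cong refl) (simp add: convolution_rng_finite[OF f])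
  also have "\<dots> = (\<Sum>c\<in>C. \<Sum>a\<in>?A. f a * (g (cmp G (ginv G a) c) * h (cmp G (ginv G c) x)))"
    by (simp add: sum_distrib_right mult.assoc)
  also have "\<dots> = (\<Sum>a\<in>?A. \<Sum>c\<in>C. f a * (g (cmp G (ginv G a) c) * h (cmp G (ginv G c) x)))"
    by (rule sum.swap)
  also have "\<dots> = (\<Sum>a\<in>?A. f a * (\<Sum>c\<in>C. g (cmp G (ginv G a) c) * h (cmp G (ginv G c) x)))"
    by (simp add: sum_distrib_left)
  also have "\<dots> = (\<Sum>a\<in>?A. f a * convolution G g h (cmp G (ginv G a) x))"
  proof (intro sum.cong refl)
    fix a assume a: "a \<in> ?A"
    then have ra: "rng G a = rng G x" by simp
    let ?B = "cmp G (ginv G a) ` C"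
    have inj: "inj_on (cmp G (ginv G a)) C"
      by (rule inj_on_inverseI[of _ "cmp G a"]) (use ra rC in \<open>simp add: gsimps\<close>)
    have "convolution G g h (cmp G (ginv G a) x) =
        (\<Sum>b\<in>?B. g b * h (cmp G (ginv G b) (cmp G (ginv G a) x)))"
    proof (rule convolution_eq_left)
      fix b assume b: "rng G b = rng G (cmp G (ginv G a) x)"
        "g b * h (cmp G (ginv G b) (cmp G (ginv G a) x)) \<noteq> 0"
      then have "rng G b = src G a" "g b \<noteq> 0" using ra by (auto simp: gsimps)
      then show "b \<in> ?B" using a
        by (intro image_eqI[of _ _ "cmp G a b"]) (auto simp: gsimps C_def)
    next
      show "finite ?B" using fC by blast
    next
      fix b assume "b \<in> ?B"
      then obtain c where "c \<in> C" "b = cmp G (ginv G a) c" by blast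
      then show "rng G b = rng G (cmp G (ginv G a) x)"
        using rC[of c] ra by (simp add: gsimps)
    qed
    also have "\<dots> = (\<Sum>c\<in>C. g (cmp G (ginv G a) c) * h (cmp G (ginv G c) x))"
    proof (subst sum.reindex[OF inj], rule sum.cong[OF refl])
      fix c assume "c \<in> C"
      then have "rng G c = rng G x" by (rule rC)
      then show "((\<lambda>b. g b * h (cmp G (ginv G b) (cmp G (ginv G a) x))) \<circ> cmp G (ginv G a)) c =
          g (cmp G (ginv G a) c) * h (cmp G (ginv G c) x)"
        using ra by (simp add: gsimps)
    qed
    finally show "f a * (\<Sum>c\<in>C. g (cmp G (ginv G a) c) * h (cmp G (ginv G c) x)) =
        f a * convolution G g h (cmp G (ginv G a) x)" by simp
  qed
  also have "\<dots> = convolution G f (convolution G g h) x"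
    by (rule convolution_rng_finite[OF f, symmetric])
  finally show "convolution G (convolution G f g) h x = convolution G f (convolution G g h) x" .
qed

lemma convolution_add_right:
  assumes "rng_finite f"
  shows "convolution G f (\<lambda>x. g x + h x) = (\<lambda>x. convolution G f g x + convolution G f h x)"
  by (simp add: fun_eq_iff convolution_rng_finite[OF assms] distrib_left sum.distrib)

lemma convolution_add_left:
  assumes f: "rng_finite f" and g: "rng_finite g"
  shows "convolution G (\<lambda>x. f x + g x) h = (\<lambda>x. convolution G f h x + convolution G g h x)"
proof
  fix x
  let ?A = "{a. rng G a = rng G x \<and> f a \<noteq> 0} \<union> {a. rng G a = rng G x \<and> g a \<noteq> 0}"
  have A: "finite ?A" "\<And>a. a \<in> ?A \<Longrightarrow> rng G a = rng G x" using f g by (auto simp: rng_finite_def)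
  have "convolution G (\<lambda>x. f x + g x) h x = (\<Sum>a\<in>?A. (f a + g a) * h (cmp G (ginv G a) x))"
    by (rule convolution_eq_left[OF A]) auto
  also have "\<dots> = (\<Sum>a\<in>?A. f a * h (cmp G (ginv G a) x)) + (\<Sum>a\<in>?A. g a * h (cmp G (ginv G a) x))"
    by (simp only: distrib_right sum.distrib)
  also have "(\<Sum>a\<in>?A. f a * h (cmp G (ginv G a) x)) = convolution G f h x"
    by (rule convolution_eq_left[OF A, symmetric]) auto
  also have "(\<Sum>a\<in>?A. g a * h (cmp G (ginv G a) x)) = convolution G g h x"
    by (rule convolution_eq_left[OF A, symmetric]) auto
  finally show "convolution G (\<lambda>x. f x + g x) h x = convolution G f h x + convolution G g h x" .
qed

lemma convolution_diff_right:
  assumes "rng_finite f"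
  shows "convolution G f (\<lambda>x. g x - h x) = (\<lambda>x. convolution G f g x - convolution G f h x)"
  by (simp add: fun_eq_iff convolution_rng_finite[OF assms] right_diff_distrib sum_subtractf)

lemma convolution_diff_left:
  assumes f: "rng_finite f" and g: "rng_finite g"
  shows "convolution G (\<lambda>x. f x - g x) h = (\<lambda>x. convolution G f h x - convolution G g h x)"
  using convolution_add_left[OF rng_finite_diff[OF f g] g, of h] by (simp add: fun_eq_iff eq_diff_eq)

lemma convolution_cong_left:
  assumes "\<And>a. rng G a = rng G x \<Longrightarrow> f a = f' a"
  shows "convolution G f h x = convolution G f' h x"
proof -
  have "{(a, b). (a, b) \<in> composable G \<and> cmp G a b = x \<and> f a * h b \<noteq> 0} =
      {(a, b). (a, b) \<in> composable G \<and> cmp G a b = x \<and> f' a * h b \<noteq> 0}"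
    using assms by (auto simp: composable_def gsimps)
  then show ?thesis
    unfolding convolution_def using assms by (auto intro!: sum.cong simp: composable_def gsimps)
qed

text \<open>Only one arrow of \<open>U\<close> has the range of \<open>x\<close>, so left
  multiplication by \<open>indicator U\<close> is translation by the inverse of that arrow.\<close>

lemma convolution_indicator_left:
  assumes U: "inj_on (rng G) U" and u: "u \<in> U" "rng G u = rng G x"
  shows "convolution G (\<lambda>a. c * indicator U a) h x = c * h (cmp G (ginv G u) x)"
proof -
  have "convolution G (\<lambda>a. c * indicator U a) h x =
      (\<Sum>a\<in>{u}. c * indicator U a * h (cmp G (ginv G a) x))"
  proof (rule convolution_eq_left)
    fix a assume a: "rng G a = rng G x" "c * indicator U a * h (cmp G (ginv G a) x) \<noteq> 0"
    then have aU: "a \<in> U" by (cases "a \<in> U") auto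
    have "a = u" by (rule inj_onD[OF U _ aU u(1)]) (use u a(1) in simp)
    then show "a \<in> {u}" by simp
  qed (use u in auto)
  then show ?thesis using u by simp
qed

lemma convolution_indicator_left_0:
  assumes "rng G x \<notin> rng G ` U"
  shows "convolution G (\<lambda>a. c * indicator U a) h x = 0"
proof -
  have "convolution G (\<lambda>a. c * indicator U a) h x =
      (\<Sum>a\<in>{}. c * indicator U a * h (cmp G (ginv G a) x))"
  proof (rule convolution_eq_left)
    fix a assume a: "rng G a = rng G x" "c * indicator U a * h (cmp G (ginv G a) x) \<noteq> 0"
    then have "a \<in> U" by (cases "a \<in> U") auto
    then show "a \<in> {}" using assms a(1) by (metis imageI)
  qed auto
  then show ?thesis by simp
qed

text \<open>Here the translating arrow is a unit, so nothing is moved and only a cut-off by the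
  range remains.\<close>

lemma convolution_unit_indicator_left:
  assumes "K \<subseteq> units_of_groupoid G"
  shows "convolution G (\<lambda>a. c * indicator K a) h x = c * indicator K (rng G x) * h x"
proof (cases "rng G x \<in> K")
  case True
  have "inj_on (rng G) K" using assms by (metis inj_onI subsetD unit_iff')
  from convolution_indicator_left[OF this True, of x] show ?thesis
    using True by (simp add: gsimps ginv_unit)
next
  case False
  have "rng G ` K = K" using assms unit_iff' by force
  then show ?thesis using False by (simp add: convolution_indicator_left_0)
qed

lemma convolution_unit_indicator_right:
  assumes "K \<subseteq> units_of_groupoid G"
  shows "convolution G h (\<lambda>a. c * indicator K a) x = h x * (c * indicator K (src G x))"
proof -
  have "convolution G h (\<lambda>a. c * indicator K a) x =
      (\<Sum>b\<in>{src G x}. h (cmp G x (ginv G b)) * (c * indicator K b))"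
  proof (rule convolution_eq_right)
    fix b assume b: "src G b = src G x" "h (cmp G x (ginv G b)) * (c * indicator K b) \<noteq> 0"
    then have "b \<in> K" by (cases "b \<in> K") auto
    then show "b \<in> {src G x}" using assms b(1) by (metis singletonI subsetD unit_iff)
  qed (auto simp: gsimps)
  then show ?thesis by (simp add: gsimps ginv_unit)
qed

section \<open>Products of sets of arrows\<close>

definition gprod :: "'g set \<Rightarrow> 'g set \<Rightarrow> 'g set" where
  "gprod A B = {cmp G a b | a b. a \<in> A \<and> b \<in> B \<and> src G a = rng G b}"

lemma gprodI: "a \<in> A \<Longrightarrow> b \<in> B \<Longrightarrow> src G a = rng G b \<Longrightarrow> cmp G a b \<in> gprod A B"
  unfolding gprod_def by blast

lemma gprodE:
  assumes "c \<in> gprod A B"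
  obtains a b where "a \<in> A" "b \<in> B" "src G a = rng G b" "c = cmp G a b"
  using assms unfolding gprod_def by blast

lemma inj_on_rng_gprod:
  assumes U: "inj_on (rng G) U" and V: "inj_on (rng G) V"
  shows "inj_on (rng G) (gprod U V)"
proof (rule inj_onI)
  fix c d assume "c \<in> gprod U V" "d \<in> gprod U V" and eq: "rng G c = rng G d"
  then obtain a b a' b' where *: "a \<in> U" "b \<in> V" "src G a = rng G b" "c = cmp G a b"
    "a' \<in> U" "b' \<in> V" "src G a' = rng G b'" "d = cmp G a' b'" by (auto elim!: gprodE)
  then have "a = a'" using eq inj_onD[OF U, of a a'] by (simp add: gsimps)
  moreover from this have "b = b'" using * inj_onD[OF V, of b b'] by (simp add: gsimps)
  ultimately show "c = d" using * by simp
qed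

lemma inj_on_src_gprod:
  assumes U: "inj_on (src G) U" and V: "inj_on (src G) V"
  shows "inj_on (src G) (gprod U V)"
proof (rule inj_onI)
  fix c d assume "c \<in> gprod U V" "d \<in> gprod U V" and eq: "src G c = src G d"
  then obtain a b a' b' where *: "a \<in> U" "b \<in> V" "src G a = rng G b" "c = cmp G a b"
    "a' \<in> U" "b' \<in> V" "src G a' = rng G b'" "d = cmp G a' b'" by (auto elim!: gprodE)
  then have "b = b'" using eq inj_onD[OF V, of b b'] by (simp add: gsimps)
  moreover from this have "a = a'" using * inj_onD[OF U, of a a'] by (simp add: gsimps)
  ultimately show "c = d" using * by simp
qed

text \<open>Injectivity of the range map on \<open>U\<close> allows each arrow at most one
  factorization with left factor in \<open>U\<close>, so every product in \<open>gprod U V\<close>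
  is counted exactly once.\<close>

lemma convolution_indicator_indicator:
  assumes U: "inj_on (rng G) U"
  shows "convolution G (\<lambda>x. c * indicator U x) (\<lambda>x. d * indicator V x) =
    (\<lambda>x. c * d * indicator (gprod U V) x)"
proof
  fix x
  show "convolution G (\<lambda>x. c * indicator U x) (\<lambda>x. d * indicator V x) x =
    c * d * indicator (gprod U V) x"
  proof (cases "rng G x \<in> rng G ` U")
    case True
    then obtain u where u: "u \<in> U" "rng G u = rng G x" by (metis imageE)
    have "x \<in> gprod U V \<longleftrightarrow> cmp G (ginv G u) x \<in> V"
    proof
      assume "x \<in> gprod U V"
      then obtain a b where *: "a \<in> U" "b \<in> V" "src G a = rng G b" "x = cmp G a b" by (rule gprodE)
      then have "a = u" using u inj_onD[OF U, of a u] by (simp add: gsimps)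
      then show "cmp G (ginv G u) x \<in> V" using * by (simp add: gsimps)
    next
      assume "cmp G (ginv G u) x \<in> V"
      then have "cmp G u (cmp G (ginv G u) x) \<in> gprod U V"
        using u by (intro gprodI) (auto simp: gsimps)
      then show "x \<in> gprod U V" using u by (simp add: gsimps)
    qed
    then show ?thesis
      using convolution_indicator_left[OF U u, of c "\<lambda>x. d * indicator V x"]
      by (simp add: mult.assoc split: split_indicator)
  next
    case False
    then have "x \<notin> gprod U V" by (auto elim!: gprodE simp: gsimps)
    then show ?thesis using convolution_indicator_left_0[OF False] by simp
  qed
qed

end

subsection \<open>Compact open bisections\<close>

context topological_groupoid
begin

text \<open>The axioms give continuity of composition and inversion only; the range map inherits it
  through \<open>cmp G a (ginv G a)\<close>.\<close>

lemma continuous_rng: "continuous_on UNIV (rng G)"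
proof -
  have "continuous_on UNIV (\<lambda>a. case (a, ginv G a) of (a, b) \<Rightarrow> cmp G a b)"
    by (rule continuous_on_compose2[OF continuous_cmp])
      (auto intro!: continuous_intros continuous_ginv simp: composable_def gsimps)
  then show ?thesis by (simp add: gsimps)
qed

lemma continuous_src: "continuous_on UNIV (src G)"
  using continuous_on_compose2[OF continuous_rng continuous_ginv] by (simp add: gsimps)

lemma open_vimage_rng: "open V \<Longrightarrow> open (rng G -` V)"
  by (rule open_vimage[OF _ continuous_rng])

lemma open_vimage_src: "open V \<Longrightarrow> open (src G -` V)"
  by (rule open_vimage[OF _ continuous_src])

lemma ginv_image_eq_vimage: "ginv G ` U = ginv G -` U"
  by (auto simp: gsimps intro: rev_image_eqI[of "ginv G _"])

lemma open_ginv_image: "open U \<Longrightarrow> open (ginv G ` U)"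
  by (simp add: ginv_image_eq_vimage open_vimage[OF _ continuous_ginv])

lemma compact_ginv_image: "compact U \<Longrightarrow> compact (ginv G ` U)"
  by (rule compact_continuous_image) (auto intro: continuous_on_subset[OF continuous_ginv])

lemma compact_rng_image: "compact U \<Longrightarrow> compact (rng G ` U)"
  by (rule compact_continuous_image) (auto intro: continuous_on_subset[OF continuous_rng])

lemma compact_src_image: "compact U \<Longrightarrow> compact (src G ` U)"
  by (rule compact_continuous_image) (auto intro: continuous_on_subset[OF continuous_src])

end

context etale_groupoid
begin

text \<open>If the range map is injective on a neighbourhood \<open>U\<close> of a unit and both
  \<open>c\<close> and \<open>rng G c\<close> lie in \<open>U\<close>, they have the same range and
  therefore coincide.\<close>

lemma open_units: "open (units_of_groupoid G)"
proof (rule topological_space_class.openI)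
  show "\<exists>T. open T \<and> x \<in> T \<and> T \<subseteq> units_of_groupoid G" if x: "x \<in> units_of_groupoid G" for x
  proof -
    obtain U where U: "open U" "x \<in> U" "homeo_onto_open_units G (rng G) U"
      using rng_local_homeo by blast
    then have inj: "inj_on (rng G) U"
      unfolding homeo_onto_open_units_def homeomorphism_def by (metis inj_on_inverseI)
    have "U \<inter> rng G -` U \<subseteq> units_of_groupoid G"
    proof
      fix c assume "c \<in> U \<inter> rng G -` U"
      then have "rng G c = c" using inj_onD[OF inj, of "rng G c" c] by (auto simp: gsimps)
      then show "c \<in> units_of_groupoid G" by (simp add: unit_iff')
    qed
    moreover have "open (U \<inter> rng G -` U)" by (simp add: U(1) open_Int open_vimage_rng)
    moreover have "x \<in> U \<inter> rng G -` U" using x U(2) by (simp add: unit_iff')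
    ultimately show ?thesis by blast
  qed
qed

lemma openin_units: "openin (top_of_set (units_of_groupoid G)) W \<longleftrightarrow> open W \<and> W \<subseteq> units_of_groupoid G"
  by (rule openin_open_eq[OF open_units])

lemma open_rng_image:
  assumes "open U" shows "open (rng G ` U)"
proof (rule topological_space_class.openI)
  fix y assume "y \<in> rng G ` U"
  then obtain x where x: "x \<in> U" "y = rng G x" by blast
  obtain V g where V: "open V" "x \<in> V" "open (rng G ` V)"
    and g: "homeomorphism V (rng G ` V) (rng G) g"
    using rng_local_homeo[of x] by (auto simp: homeo_onto_open_units_def openin_units)
  have "openin (top_of_set (rng G ` V)) (rng G ` (V \<inter> U))"
    by (rule homeomorphism_imp_open_map[OF g]) (simp add: assms openin_open_Int)
  then have "open (rng G ` (V \<inter> U))" using V(3) by (simp add: openin_open_eq)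
  then show "\<exists>T. open T \<and> y \<in> T \<and> T \<subseteq> rng G ` U" using x V(2) by blast
qed

lemma src_eq_rng_ginv_image: "src G ` U = rng G ` ginv G ` U"
  by (simp add: image_image gsimps)

lemma open_src_image: "open U \<Longrightarrow> open (src G ` U)"
  by (simp add: src_eq_rng_ginv_image open_rng_image open_ginv_image)

lemma units_separation:
  assumes "x \<in> units_of_groupoid G" "y \<in> units_of_groupoid G" "x \<noteq> y"
  shows "\<exists>A B. open A \<and> open B \<and> x \<in> A \<and> y \<in> B \<and> A \<inter> B = {}"
  using units_Hausdorff assms unfolding Hausdorff_space_def openin_units disjnt_def
  by (metis topspace_euclidean_subtopology)

text \<open>Compact sets of arrows may fail to be closed, but compact sets of units are closed in
  the Hausdorff unit space. Since that space is open in the type of arrows, the relative complement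
  is open there too.\<close>

lemma open_units_diff_compact:
  assumes "compact K" "K \<subseteq> units_of_groupoid G"
  shows "open (units_of_groupoid G - K)"
proof -
  have "compactin (top_of_set (units_of_groupoid G)) K"
    using assms by (simp add: compactin_subtopology)
  then have "closedin (top_of_set (units_of_groupoid G)) K"
    by (rule compactin_imp_closedin[OF units_Hausdorff])
  then show ?thesis by (simp add: closedin_def openin_units)
qed

lemma homeo_onto_open_unitsI:
  assumes "open U" "continuous_on UNIV f" "inj_on f U" "\<And>V. open V \<Longrightarrow> open (f ` V)"
    "\<And>x. f x \<in> units_of_groupoid G"
  shows "homeo_onto_open_units G f U"
proof -
  have "openin (top_of_set (f ` U)) (f ` V)" if "openin (top_of_set U) V" for V
    using that assms(1,4) by (auto simp: openin_open_eq)
  moreover have "continuous_on U f" using assms(2) continuous_on_subset by blast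
  ultimately obtain g where "homeomorphism U (f ` U) f g"
    using homeomorphism_injective_open_map[OF _ refl assms(3)] by blast
  then show ?thesis
    using assms(1,4,5) by (auto simp: homeo_onto_open_units_def openin_units)
qed

text \<open>The range and source maps are continuous and open, so injectivity alone makes them
  homeomorphisms onto open sets of units.\<close>

lemma bisection_iff: "bisection G U \<longleftrightarrow> open U \<and> inj_on (rng G) U \<and> inj_on (src G) U"
proof
  assume "bisection G U"
  then show "open U \<and> inj_on (rng G) U \<and> inj_on (src G) U"
    unfolding bisection_def homeo_onto_open_units_def homeomorphism_def by (metis inj_on_inverseI)
next
  assume "open U \<and> inj_on (rng G) U \<and> inj_on (src G) U"
  then show "bisection G U"
    unfolding bisection_def
    by (auto intro!: homeo_onto_open_unitsI open_rng_image open_src_image continuous_rng continuous_src)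
qed

text \<open>Distinct points of \<open>U\<close> have distinct ranges, and preimages of separating
  sets in the unit space separate them. This makes the Hausdorff clause in
  \<open>compact_bisections\<close> automatic.\<close>

lemma Hausdorff_space_bisection:
  assumes inj: "inj_on (rng G) U"
  shows "Hausdorff_space (top_of_set U)"
  unfolding Hausdorff_space_def
proof (intro allI impI)
  fix x y assume xy: "x \<in> topspace (top_of_set U) \<and> y \<in> topspace (top_of_set U) \<and> x \<noteq> y"
  then have "rng G x \<noteq> rng G y" using inj by (auto dest: inj_onD)
  then obtain A B where "open A" "open B" "rng G x \<in> A" "rng G y \<in> B" "A \<inter> B = {}"
    using units_separation[of "rng G x" "rng G y"] by auto
  then show "\<exists>V W. openin (top_of_set U) V \<and> openin (top_of_set U) W \<and> x \<in> V \<and> y \<in> W \<and> disjnt V W"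
    using xy by (intro exI[of _ "U \<inter> rng G -` A"] exI[of _ "U \<inter> rng G -` B"])
      (auto simp: open_vimage_rng openin_open_Int disjnt_def)
qed

lemma compact_bisections_iff:
  "U \<in> compact_bisections G \<longleftrightarrow> open U \<and> compact U \<and> inj_on (rng G) U \<and> inj_on (src G) U"
  by (auto simp: compact_bisections_def bisection_iff compact_hausdorff_def Hausdorff_space_bisection)

text \<open>Near a product \<open>c\<close> of \<open>a\<close> and \<open>b\<close>, a local
  section of the range map through \<open>a\<close> supplies left factors that vary continuously,
  and the corresponding right factors stay in \<open>B\<close>.\<close>

lemma open_gprod:
  assumes A: "open A" and B: "open B"
  shows "open (gprod A B)"
proof (rule topological_space_class.openI)
  fix c assume "c \<in> gprod A B"
  then obtain a b where ab: "a \<in> A" "b \<in> B" "src G a = rng G b" "c = cmp G a b" by (rule gprodE)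
  obtain V g where V: "open V" "a \<in> V" "open (rng G ` V)"
    and g: "homeomorphism V (rng G ` V) (rng G) g"
    using rng_local_homeo[of a] by (auto simp: homeo_onto_open_units_def openin_units)
  define U where "U = V \<inter> A"
  have U: "open U" "a \<in> U" "U \<subseteq> A" "open (rng G ` U)"
    using V(1,2) A ab by (auto simp: U_def open_rng_image open_Int)
  have gr: "g (rng G u) = u" if "u \<in> U" for u
    using g that by (simp add: U_def homeomorphism_def)
  have cg: "continuous_on (rng G ` U) g"
    by (rule continuous_on_subset[of "rng G ` V"]) (use g in \<open>auto simp: U_def homeomorphism_def\<close>)
  let ?D = "rng G -` (rng G ` U)"
  \<comment> \<open>The right factor of \<open>x\<close> once the left factor is the value of the
    section \<open>g\<close> at \<open>rng G x\<close>.\<close>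
  let ?f = "\<lambda>x. cmp G (ginv G (g (rng G x))) x"
  have oD: "open ?D" by (rule open_vimage_rng[OF U(4)])
  have rg: "rng G (g (rng G x)) = rng G x" "g (rng G x) \<in> U" if "x \<in> ?D" for x
    using that gr by auto
  have "continuous_on ?D (\<lambda>x. g (rng G x))"
    by (rule continuous_on_compose2[OF cg]) (auto intro: continuous_on_subset[OF continuous_rng])
  then have "continuous_on ?D (\<lambda>x. ginv G (g (rng G x)))"
    by (rule continuous_on_compose2[OF continuous_ginv]) auto
  then have "continuous_on ?D (\<lambda>x. (ginv G (g (rng G x)), x))"
    by (intro continuous_intros)
  then have "continuous_on ?D (\<lambda>x. case (ginv G (g (rng G x)), x) of (a, b) \<Rightarrow> cmp G a b)"
    by (rule continuous_on_compose2[OF continuous_cmp]) (auto simp: composable_def gsimps rg gr)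
  then have "continuous_on ?D ?f" by simp
  then have "open (?D \<inter> ?f -` B)"
    using oD B by (metis continuous_on_open_vimage Int_commute)
  moreover have "c \<in> ?D \<inter> ?f -` B" using ab U(2) by (auto simp: gsimps gr)
  moreover have "?D \<inter> ?f -` B \<subseteq> gprod A B"
  proof
    fix x assume x: "x \<in> ?D \<inter> ?f -` B"
    then have "cmp G (g (rng G x)) (?f x) \<in> gprod A B"
      using rg[of x] U(3) by (intro gprodI) (auto simp: gsimps)
    then show "x \<in> gprod A B" using rg[of x] x by (simp add: gsimps)
  qed
  ultimately show "\<exists>T. open T \<and> c \<in> T \<and> T \<subseteq> gprod A B" by blast
qed

text \<open>Since the unit space is Hausdorff, the composable pairs form a closed set; its part in
  \<open>A \<times> B\<close> is compact and composition maps it continuously onto the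
  product.\<close>

lemma compact_gprod:
  assumes A: "compact A" and B: "compact B"
  shows "compact (gprod A B)"
proof -
  have "open (- composable G)"
  proof (rule topological_space_class.openI)
    fix p assume p: "p \<in> - composable G"
    obtain a b where ab: "p = (a, b)" by fastforce
    then have "src G a \<noteq> rng G b" using p by (auto simp: composable_def)
    then obtain U V where UV: "open U" "open V" "src G a \<in> U" "rng G b \<in> V" "U \<inter> V = {}"
      using units_separation[of "src G a" "rng G b"] by auto
    then show "\<exists>T. open T \<and> p \<in> T \<and> T \<subseteq> - composable G"
      using ab by (intro exI[of _ "(src G -` U) \<times> (rng G -` V)"])
        (auto simp: open_Times open_vimage_rng open_vimage_src composable_def)
  qed
  then have "compact (A \<times> B - - composable G)"
    by (intro compact_diff compact_Times A B)
  then have "compact ((\<lambda>(a, b). cmp G a b) ` (A \<times> B - - composable G))"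
    by (rule compact_continuous_image[rotated]) (auto intro: continuous_on_subset[OF continuous_cmp])
  also have "(\<lambda>(a, b). cmp G a b) ` (A \<times> B - - composable G) = gprod A B"
    by (auto simp: gprod_def composable_def)
  finally show ?thesis .
qed

lemma compact_bisections_gprod:
  "U \<in> compact_bisections G \<Longrightarrow> V \<in> compact_bisections G \<Longrightarrow> gprod U V \<in> compact_bisections G"
  by (simp add: compact_bisections_iff open_gprod compact_gprod inj_on_rng_gprod inj_on_src_gprod)

lemma compact_bisections_units:
  assumes "open K" "compact K" "K \<subseteq> units_of_groupoid G"
  shows "K \<in> compact_bisections G"
proof -
  have "inj_on (rng G) K" "inj_on (src G) K"
    using assms(3) by (metis inj_onI subsetD unit_iff') (metis assms(3) inj_onI subsetD unit_iff)
  then show ?thesis using assms by (simp add: compact_bisections_iff)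
qed

lemma compact_bisections_rng: "U \<in> compact_bisections G \<Longrightarrow> rng G ` U \<in> compact_bisections G"
  by (rule compact_bisections_units)
    (auto simp: compact_bisections_iff open_rng_image compact_rng_image)

end

context ample_groupoid
begin

lemma compact_bisections_basis:
  assumes "open W" "x \<in> W"
  obtains U where "U \<in> compact_bisections G" "x \<in> U" "U \<subseteq> W"
proof -
  obtain U1 where U1: "open U1" "x \<in> U1" "homeo_onto_open_units G (rng G) U1"
    using rng_local_homeo by blast
  obtain U2 where U2: "open U2" "ginv G x \<in> U2" "homeo_onto_open_units G (rng G) U2"
    using rng_local_homeo by blast
  have inj1: "inj_on (rng G) U1" and inj2: "inj_on (rng G) U2"
    using U1(3) U2(3) unfolding homeo_onto_open_units_def homeomorphism_def
    by (metis inj_on_inverseI)+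
  define V where "V = U1 \<inter> ginv G -` U2 \<inter> W"
  have oV: "open V" and xV: "x \<in> V"
    using U1 U2 assms by (auto simp: V_def intro!: open_Int open_vimage[OF _ continuous_ginv])
  have r: "inj_on (rng G) V" using inj1 by (rule inj_on_subset) (auto simp: V_def)
  have s: "inj_on (src G) V"
  proof (rule inj_onI)
    fix a b assume "a \<in> V" "b \<in> V" "src G a = src G b"
    then have "ginv G a = ginv G b"
      using inj_onD[OF inj2, of "ginv G a" "ginv G b"] by (auto simp: V_def gsimps)
    then show "a = b" by (metis ginv_ginv)
  qed
  obtain K where K: "open K" "compact K" "K \<subseteq> units_of_groupoid G" "rng G x \<in> K" "K \<subseteq> rng G ` V"
  proof -
    have "rng G ` V \<subseteq> units_of_groupoid G" by auto
    then show ?thesis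
      using units_compact_open_basis[of "rng G ` V" "rng G x"] xV open_rng_image[OF oV] that
      by (auto simp: openin_units compact_hausdorff_def)
  qed
  obtain g where g: "homeomorphism V (rng G ` V) (rng G) g"
    using oV r s bisection_iff by (auto simp: bisection_def homeo_onto_open_units_def)
  define U where "U = V \<inter> rng G -` K"
  have "U = g ` K" using g K(5) by (auto simp: U_def homeomorphism_def image_iff)
      (metis subsetD imageE)+
  moreover have "continuous_on K g"
    by (rule continuous_on_subset[of "rng G ` V"]) (use g K(5) in \<open>auto simp: homeomorphism_def\<close>)
  ultimately have "compact U" using K(2) compact_continuous_image by blast
  moreover have "open U" using oV K(1) by (simp add: U_def open_Int open_vimage_rng)
  moreover have "inj_on (rng G) U" "inj_on (src G) U"
    using r s by (auto simp: U_def intro: inj_on_subset)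
  ultimately have "U \<in> compact_bisections G" by (simp add: compact_bisections_iff)
  moreover have "x \<in> U" "U \<subseteq> W" using xV K(4) by (auto simp: U_def V_def)
  ultimately show ?thesis by (rule that)
qed

lemma compact_cover_bisections:
  assumes "compact C" "open W" "C \<subseteq> W"
  obtains \<U> where "finite \<U>" "\<U> \<subseteq> compact_bisections G" "C \<subseteq> \<Union>\<U>" "\<Union>\<U> \<subseteq> W"
proof -
  let ?B = "{U \<in> compact_bisections G. U \<subseteq> W}"
  have "C \<subseteq> \<Union>?B"
  proof
    fix x assume "x \<in> C"
    then obtain U where "U \<in> compact_bisections G" "x \<in> U" "U \<subseteq> W"
      using compact_bisections_basis[OF assms(2), of x] assms(3) by blast
    then show "x \<in> \<Union>?B" by blast
  qed
  moreover have "\<And>U. U \<in> ?B \<Longrightarrow> open U" by (simp add: compact_bisections_iff)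
  ultimately obtain \<U> where "\<U> \<subseteq> ?B" "finite \<U>" "C \<subseteq> \<Union>\<U>"
    by (rule compactE[OF assms(1)])
  then show ?thesis by (intro that[of \<U>]) auto
qed

end

subsection \<open>The groupoid algebra\<close>

context etale_groupoid
begin

lemma groupoid_algebraI:
  "finite \<U> \<Longrightarrow> \<U> \<subseteq> compact_bisections G \<Longrightarrow> f = (\<lambda>x. \<Sum>U\<in>\<U>. c U * indicator U x) \<Longrightarrow>
    f \<in> groupoid_algebra G"
  unfolding groupoid_algebra_def by (intro CollectI exI conjI)

lemma groupoid_algebraE:
  assumes "f \<in> groupoid_algebra G"
  obtains \<U> c where "finite \<U>" "\<U> \<subseteq> compact_bisections G"
    "f = (\<lambda>x. \<Sum>U\<in>\<U>. c U * indicator U x)"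
  using assms unfolding groupoid_algebra_def by (elim CollectE exE conjE) (rule that)

lemma groupoid_algebra_indicator:
  assumes "U \<in> compact_bisections G"
  shows "(\<lambda>x. c * indicator U x) \<in> groupoid_algebra G"
proof -
  have "(\<lambda>x. c * indicator U x) = (\<lambda>x. \<Sum>V\<in>{U}. c * indicator V x)"
    by (simp only: sum.insert sum.empty finite.emptyI empty_iff not_False_eq_True add_0_right)
  then show ?thesis by (rule groupoid_algebraI[rotated 2]) (use assms in auto)
qed

lemma groupoid_algebra_zero: "(\<lambda>_. 0) \<in> groupoid_algebra G"
  by (rule groupoid_algebraI[of "{}"]) auto

lemma groupoid_algebra_add:
  assumes "f \<in> groupoid_algebra G" "h \<in> groupoid_algebra G"
  shows "(\<lambda>x. f x + h x) \<in> groupoid_algebra G"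
proof -
  obtain \<U> c where f: "finite \<U>" "\<U> \<subseteq> compact_bisections G"
    "f = (\<lambda>x. \<Sum>U\<in>\<U>. c U * indicator U x)"
    by (rule groupoid_algebraE[OF assms(1)])
  obtain \<V> d where h: "finite \<V>" "\<V> \<subseteq> compact_bisections G"
    "h = (\<lambda>x. \<Sum>U\<in>\<V>. d U * indicator U x)"
    by (rule groupoid_algebraE[OF assms(2)])
  \<comment> \<open>Both coefficient families are extended by zero to the union of the two finite
    families, so a bisection occurring in both receives the sum of its coefficients.\<close>
  let ?c = "\<lambda>U. (if U \<in> \<U> then c U else 0) + (if U \<in> \<V> then d U else 0)"
  have 1: "(\<Sum>U\<in>\<U> \<union> \<V>. (if U \<in> \<U> then c U else 0) * indicator U x) =
      (\<Sum>U\<in>\<U>. c U * indicator U x)" for x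
    using f(1) h(1) by (intro sum.mono_neutral_cong_right) auto
  have 2: "(\<Sum>U\<in>\<U> \<union> \<V>. (if U \<in> \<V> then d U else 0) * indicator U x) =
      (\<Sum>U\<in>\<V>. d U * indicator U x)" for x
    using f(1) h(1) by (intro sum.mono_neutral_cong_right) auto
  have "(\<lambda>x. f x + h x) = (\<lambda>x. \<Sum>U\<in>\<U> \<union> \<V>. ?c U * indicator U x)"
    by (simp only: distrib_right sum.distrib 1 2 f(3) h(3))
  then show ?thesis by (rule groupoid_algebraI[rotated 2]) (use f(1,2) h(1,2) in auto)
qed

lemma groupoid_algebra_uminus:
  assumes "f \<in> groupoid_algebra G"
  shows "(\<lambda>x. - f x) \<in> groupoid_algebra G"
proof -
  obtain \<U> c where f: "finite \<U>" "\<U> \<subseteq> compact_bisections G"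
    "f = (\<lambda>x. \<Sum>U\<in>\<U>. c U * indicator U x)"
    by (rule groupoid_algebraE[OF assms(1)])
  then have "(\<lambda>x. - f x) = (\<lambda>x. \<Sum>U\<in>\<U>. (- c U) * indicator U x)"
    by (simp add: sum_negf)
  then show ?thesis by (rule groupoid_algebraI[OF f(1,2)])
qed

lemma groupoid_algebra_diff:
  assumes "f \<in> groupoid_algebra G" "h \<in> groupoid_algebra G"
  shows "(\<lambda>x. f x - h x) \<in> groupoid_algebra G"
  using groupoid_algebra_add[OF assms(1) groupoid_algebra_uminus[OF assms(2)]] by simp

lemma groupoid_algebra_sum:
  assumes "finite I" "\<And>i. i \<in> I \<Longrightarrow> f i \<in> groupoid_algebra G"
  shows "(\<lambda>x. \<Sum>i\<in>I. f i x) \<in> groupoid_algebra G"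
  using assms by (induction I) (auto intro: groupoid_algebra_zero groupoid_algebra_add)

lemma groupoid_algebra_induct [consumes 1, case_names zero add]:
  assumes "f \<in> groupoid_algebra G" and "P (\<lambda>_. 0)"
    and step: "\<And>f c U. f \<in> groupoid_algebra G \<Longrightarrow> P f \<Longrightarrow> U \<in> compact_bisections G \<Longrightarrow>
      P (\<lambda>x. c * indicator U x + f x)"
  shows "P f"
proof -
  obtain \<U> c where "finite \<U>" "\<U> \<subseteq> compact_bisections G"
    "f = (\<lambda>x. \<Sum>U\<in>\<U>. c U * indicator U x)"
    by (rule groupoid_algebraE[OF assms(1)])
  then show ?thesis
  proof (induction \<U> arbitrary: f rule: finite_induct)
    case empty
    then show ?case using assms(2) by simp
  next
    case (insert U \<U>)
    let ?h = "\<lambda>x. \<Sum>U\<in>\<U>. c U * indicator U x"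
    have "?h \<in> groupoid_algebra G"
      by (rule groupoid_algebraI[OF insert.hyps(1) _ refl]) (use insert.prems(1) in blast)
    moreover have "P ?h" using insert.prems(1) by (intro insert.IH) auto
    moreover have "f = (\<lambda>x. c U * indicator U x + ?h x)"
      by (simp only: insert.prems(2) sum.insert[OF insert.hyps])
    ultimately show ?case using step[of ?h U "c U"] insert.prems(1) by blast
  qed
qed

lemma groupoid_algebra_rng_finite: "f \<in> groupoid_algebra G \<Longrightarrow> rng_finite f"
proof (induction rule: groupoid_algebra_induct)
  case (add f c U)
  then have "inj_on (rng G) U" by (simp add: compact_bisections_iff)
  then show ?case by (intro rng_finite_add rng_finite_indicator add)
qed (rule rng_finite_zero)

lemma groupoid_algebra_compact_support:
  "f \<in> groupoid_algebra G \<Longrightarrow> \<exists>C. compact C \<and> (\<forall>x. f x \<noteq> 0 \<longrightarrow> x \<in> C)"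
proof (induction rule: groupoid_algebra_induct)
  case zero
  show ?case by (intro exI[of _ "{}"]) auto
next
  case (add f c U)
  then obtain C where C: "compact C" "\<And>x. f x \<noteq> 0 \<Longrightarrow> x \<in> C" by blast
  have "x \<in> U \<union> C" if "c * indicator U x + f x \<noteq> 0" for x
    using that C(2)[of x] by (cases "x \<in> U") auto
  moreover have "compact (U \<union> C)" using C add by (simp add: compact_bisections_iff compact_Un)
  ultimately show ?case by blast
qed

text \<open>Each bisection meets a source fibre at most once, so the number of bisections in a
  representation of \<open>f\<close> is a bound valid for all \<open>x\<close> simultaneously. This
  uniformity later bounds word lengths.\<close>

lemma groupoid_algebra_src_fibre_card:
  "f \<in> groupoid_algebra G \<Longrightarrow> \<exists>N. \<forall>x. finite {a. src G a = x \<and> f a \<noteq> 0} \<and> card {a. src G a = x \<and> f a \<noteq> 0} \<le> N"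
proof (induction rule: groupoid_algebra_induct)
  case zero
  show ?case by simp
next
  case (add f c U)
  then obtain N where N: "\<And>x. finite {a. src G a = x \<and> f a \<noteq> 0}"
    "\<And>x. card {a. src G a = x \<and> f a \<noteq> 0} \<le> N" by blast
  have "finite {a. src G a = x \<and> c * indicator U a + f a \<noteq> 0} \<and>
      card {a. src G a = x \<and> c * indicator U a + f a \<noteq> 0} \<le> Suc N" for x
  proof -
    let ?A = "{a. src G a = x \<and> f a \<noteq> 0}"
    define u where "u = (THE a. a \<in> U \<and> src G a = x)"
    have "a = u" if "a \<in> U" "src G a = x" for a
    proof -
      have "inj_on (src G) U" using \<open>U \<in> compact_bisections G\<close> by (simp add: compact_bisections_iff)
      then show ?thesis
        unfolding u_def using that by (intro the_equality[symmetric]) (auto simp: inj_on_def)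
    qed
    moreover have "a \<in> U" if "c * indicator U a + f a \<noteq> 0" "f a = 0" for a
      using that by (cases "a \<in> U") auto
    ultimately have sub: "{a. src G a = x \<and> c * indicator U a + f a \<noteq> 0} \<subseteq> insert u ?A" by blast
    have fin: "finite (insert u ?A)" using N(1) by simp
    have "card {a. src G a = x \<and> c * indicator U a + f a \<noteq> 0} \<le> card (insert u ?A)"
      by (rule card_mono[OF fin sub])
    also have "\<dots> \<le> Suc N" using N(2)[of x] N(1)[of x] by (simp add: card_insert_if)
    finally show ?thesis using finite_subset[OF sub fin] by blast
  qed
  then show ?case by blast
qed

text \<open>Two inductions reduce the claim by distributivity to indicators, where the product is
  again the indicator of a compact open bisection, namely \<open>gprod U V\<close>.\<close>

lemma groupoid_algebra_convolution:
  assumes f: "f \<in> groupoid_algebra G" and h: "h \<in> groupoid_algebra G"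
  shows "convolution G f h \<in> groupoid_algebra G"
  using f
proof (induction rule: groupoid_algebra_induct)
  case zero
  have "convolution G (\<lambda>_. 0) h = (\<lambda>_. 0)"
    by (simp add: fun_eq_iff convolution_rng_finite rng_finite_zero)
  then show ?case by (simp add: groupoid_algebra_zero)
next
  case (add f c U)
  have fin: "rng_finite (\<lambda>x. c * indicator U x)" and inj: "inj_on (rng G) U"
    using \<open>U \<in> compact_bisections G\<close> by (auto simp: compact_bisections_iff rng_finite_indicator)
  from h have "convolution G (\<lambda>x. c * indicator U x) h \<in> groupoid_algebra G"
  proof (induction rule: groupoid_algebra_induct)
    case zero
    have "convolution G (\<lambda>x. c * indicator U x) (\<lambda>_. 0) = (\<lambda>_. 0)"
      by (simp add: fun_eq_iff convolution_rng_finite fin)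
    then show ?case by (simp add: groupoid_algebra_zero)
  next
    case (add h d V)
    then show ?case
      using \<open>U \<in> compact_bisections G\<close>
      by (simp add: convolution_add_right[OF fin] convolution_indicator_indicator[OF inj]
          groupoid_algebra_add groupoid_algebra_indicator compact_bisections_gprod)
  qed
  then show ?case
    using add by (simp add: convolution_add_left[OF fin groupoid_algebra_rng_finite] groupoid_algebra_add)
qed

text \<open>
  Although \<open>G\<close> need not be Hausdorff, two compact open bisections through the same arrow over \<open>x\<close>
  agree near \<open>x\<close>, and a bisection with no arrow over \<open>x\<close> misses a neighbourhood of \<open>x\<close>; so near \<open>x\<close>
  an element of the algebra is determined by its values over \<open>x\<close>.
\<close>

lemma groupoid_algebra_germ_zero:
  assumes f: "f \<in> groupoid_algebra G" and x: "x \<in> units_of_groupoid G"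
    and zero: "\<And>a. rng G a = x \<Longrightarrow> f a = 0"
  shows "\<exists>V. open V \<and> x \<in> V \<and> (\<forall>a. rng G a \<in> V \<longrightarrow> f a = 0)"
proof -
  obtain \<U> c where \<U>: "finite \<U>" "\<U> \<subseteq> compact_bisections G"
    and f_eq: "f = (\<lambda>x. \<Sum>U\<in>\<U>. c U * indicator U x)"
    by (rule groupoid_algebraE[OF f])
  have inj: "inj_on (rng G) U" and oU: "open U" and cU: "compact U" if "U \<in> \<U>" for U
    using \<U>(2) that by (auto simp: compact_bisections_iff)
  define \<X> where "\<X> = {U \<in> \<U>. x \<in> rng G ` U}"
  have fin\<X>: "finite \<X>" using \<U>(1) by (simp add: \<X>_def)
  define g where "g U = inv_into U (rng G) x" for U
  have g: "g U \<in> U" "rng G (g U) = x" if "U \<in> \<X>" for U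
    using that by (auto simp: \<X>_def g_def inv_into_into f_inv_into_f)
  define P where "P = {(U, W). U \<in> \<X> \<and> W \<in> \<X> \<and> g U = g W}"
  have finP: "finite P" by (rule finite_subset[of _ "\<X> \<times> \<X>"]) (auto simp: P_def fin\<X>)
  \<comment> \<open>The first intersection removes the ranges of the bisections without an arrow
    over \<open>x\<close>. The second forces two bisections through the same arrow over
    \<open>x\<close> to contain a common arrow over every point of \<open>V\<close>.\<close>
  define V where "V = (\<Inter>U\<in>\<U> - \<X>. units_of_groupoid G - rng G ` U) \<inter> (\<Inter>(U, W)\<in>P. rng G ` (U \<inter> W))"
  have "open V" unfolding V_def
  proof (intro open_Int open_INT ballI)
    show "open (units_of_groupoid G - rng G ` U)" if "U \<in> \<U> - \<X>" for U
      using that cU by (intro open_units_diff_compact compact_rng_image) auto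
    show "open (case p of (U, W) \<Rightarrow> rng G ` (U \<inter> W))" if "p \<in> P" for p
      using that oU by (auto simp: P_def \<X>_def intro!: open_rng_image open_Int)
  qed (use \<U>(1) finP in auto)
  moreover have "x \<in> V"
  proof -
    have "x \<in> rng G ` (U \<inter> W)" if "(U, W) \<in> P" for U W
      using that g[of U] g[of W] by (auto simp: P_def intro!: image_eqI[of _ _ "g U"])
    then show ?thesis using x by (auto simp: V_def \<X>_def)
  qed
  moreover have "f a = 0" if a: "rng G a \<in> V" for a
  proof -
    define \<S> where "\<S> = {U \<in> \<X>. a \<in> U}"
    have closed: "W \<in> \<S>" if "U \<in> \<S>" "W \<in> \<X>" "g W = g U" for U W
    proof -
      have "(U, W) \<in> P" using that by (auto simp: P_def \<S>_def)
      then have "rng G a \<in> rng G ` (U \<inter> W)" using a by (auto simp: V_def)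
      then obtain b where b: "b \<in> U" "b \<in> W" "rng G b = rng G a" by (metis IntE imageE)
      then have "b = a" using inj_onD[OF inj, of U b a] that by (auto simp: \<S>_def \<X>_def)
      then show ?thesis using b that by (simp add: \<S>_def)
    qed
    have "f a = (\<Sum>U\<in>\<S>. c U)"
      unfolding f_eq
    proof (rule sum.mono_neutral_cong_right[OF \<U>(1)])
      show "\<forall>U\<in>\<U> - \<S>. c U * indicator U a = 0"
      proof
        fix U assume U: "U \<in> \<U> - \<S>"
        have "a \<notin> U"
        proof
          assume aU: "a \<in> U"
          then have "U \<in> \<U> - \<X>" using U by (auto simp: \<S>_def)
          then have "rng G a \<notin> rng G ` U" using a unfolding V_def by blast
          then show False using aU by blast
        qed
        then show "c U * indicator U a = 0" by simp
      qed
    qed (auto simp: \<S>_def \<X>_def)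
    \<comment> \<open>The bisections through \<open>a\<close> are grouped by their arrow
      \<open>t\<close> over \<open>x\<close>. By \<open>closed\<close> a group contains all
      bisections of the family through \<open>t\<close>, so its coefficients add up to
      \<open>f t\<close>.\<close>
    also have "\<dots> = (\<Sum>t\<in>g ` \<S>. \<Sum>U | U \<in> \<S> \<and> g U = t. c U)"
      by (rule sum.image_gen) (simp add: \<S>_def fin\<X>)
    also have "\<dots> = (\<Sum>t\<in>g ` \<S>. f t)"
    proof (rule sum.cong[OF refl])
      fix t assume "t \<in> g ` \<S>"
      then obtain U where U: "U \<in> \<S>" "t = g U" by blast
      then have rt: "rng G t = x" using g(2)[of U] by (simp add: \<S>_def)
      show "(\<Sum>U | U \<in> \<S> \<and> g U = t. c U) = f t"
        unfolding f_eq
      proof (rule sum.mono_neutral_cong_left[OF \<U>(1)])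
        show "\<forall>W\<in>\<U> - {W \<in> \<S>. g W = t}. c W * indicator W t = 0"
        proof
          fix W assume W: "W \<in> \<U> - {W \<in> \<S>. g W = t}"
          have "t \<notin> W"
          proof
            assume t: "t \<in> W"
            then have W': "W \<in> \<X>" using W rt by (auto simp: \<X>_def)
            then have "g W = t" using g[OF W'] t rt W inj_onD[OF inj, of W "g W" t] by auto
            then show False using W' W U closed[of U W] by auto
          qed
          then show "c W * indicator W t = 0" by simp
        qed
        show "{W \<in> \<S>. g W = t} \<subseteq> \<U>" by (auto simp: \<S>_def \<X>_def)
        show "c W = c W * indicator W t" if "W \<in> {W \<in> \<S>. g W = t}" for W
          using that g(1)[of W] by (auto simp: \<S>_def)
      qed
    qed
    also have "\<dots> = 0"
      by (rule sum.neutral) (use zero g(2) in \<open>auto simp: \<S>_def\<close>)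
    finally show ?thesis .
  qed
  ultimately show ?thesis by blast
qed

end

subsection \<open>Necessity\<close>

context groupoid
begin

lemma group_isotropy_group:
  assumes "x \<in> units_of_groupoid G" shows "group (isotropy_group G x)"
proof (rule groupI)
  fix a assume "a \<in> carrier (isotropy_group G x)"
  then show "\<exists>b\<in>carrier (isotropy_group G x). b \<otimes>\<^bsub>isotropy_group G x\<^esub> a = \<one>\<^bsub>isotropy_group G x\<^esub>"
    by (intro bexI[of _ "ginv G a"]) (auto simp: isotropy_group_def gsimps)
qed (use assms in \<open>auto simp: isotropy_group_def gsimps simp flip: unit_iff unit_iff'\<close>)

lemma inv_isotropy_group:
  assumes "x \<in> units_of_groupoid G" "a \<in> carrier (isotropy_group G x)"
  shows "inv\<^bsub>isotropy_group G x\<^esub> a = ginv G a"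
  by (rule group.inv_equality[OF group_isotropy_group[OF assms(1)]])
    (use assms in \<open>auto simp: isotropy_group_def gsimps\<close>)

section \<open>The augmentation map\<close>

text \<open>For a group this is the usual augmentation of the group ring; in general it is the
  result of letting \<open>f\<close> act on the constant function one on the unit space.\<close>

definition augmentation :: "('g \<Rightarrow> 'r::ring_1) \<Rightarrow> 'g \<Rightarrow> 'r" where
  "augmentation f x = (\<Sum>a | rng G a = x \<and> f a \<noteq> 0. f a)"

lemma augmentation_eq:
  assumes "finite A" "\<And>a. a \<in> A \<Longrightarrow> rng G a = x" "\<And>a. rng G a = x \<Longrightarrow> f a \<noteq> 0 \<Longrightarrow> a \<in> A"
  shows "augmentation f x = (\<Sum>a\<in>A. f a)"
  unfolding augmentation_def by (rule sum.mono_neutral_left) (use assms in auto)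

lemma augmentation_add:
  assumes "rng_finite f" "rng_finite h"
  shows "augmentation (\<lambda>a. f a + h a) x = augmentation f x + augmentation h x"
proof -
  let ?A = "{a. rng G a = x \<and> f a \<noteq> 0} \<union> {a. rng G a = x \<and> h a \<noteq> 0}"
  have fin: "finite ?A" using assms by (auto simp: rng_finite_def)
  have "augmentation (\<lambda>a. f a + h a) x = (\<Sum>a\<in>?A. f a + h a)"
    by (rule augmentation_eq[OF fin]) auto
  also have "\<dots> = (\<Sum>a\<in>?A. f a) + (\<Sum>a\<in>?A. h a)" by (rule sum.distrib)
  also have "(\<Sum>a\<in>?A. f a) = augmentation f x"
    by (rule augmentation_eq[OF fin, symmetric]) auto
  also have "(\<Sum>a\<in>?A. h a) = augmentation h x"
    by (rule augmentation_eq[OF fin, symmetric]) auto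
  finally show ?thesis .
qed

lemma augmentation_diff:
  assumes "rng_finite f" "rng_finite h"
  shows "augmentation (\<lambda>a. f a - h a) x = augmentation f x - augmentation h x"
  using augmentation_add[OF rng_finite_diff[OF assms] assms(2), of x] by simp

lemma augmentation_indicator:
  assumes "inj_on (rng G) U"
  shows "augmentation (\<lambda>a. c * indicator U a) x = c * indicator (rng G ` U) x"
proof (cases "x \<in> rng G ` U")
  case True
  then obtain u where u: "u \<in> U" "rng G u = x" by blast
  have "augmentation (\<lambda>a. c * indicator U a) x = (\<Sum>a\<in>{u}. c * indicator U a)"
  proof (rule augmentation_eq)
    fix a assume a: "rng G a = x" "c * indicator U a \<noteq> 0"
    then have "a \<in> U" by (cases "a \<in> U") auto
    then show "a \<in> {u}" using inj_onD[OF assms, of a u] u a by auto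
  qed (use u in auto)
  also have "\<dots> = c" using u(1) by simp
  finally show ?thesis using True by simp
next
  case False
  then have "augmentation (\<lambda>a. c * indicator U a) x = (\<Sum>a\<in>{}. c * indicator U a)"
    by (intro augmentation_eq) (auto split: split_indicator_asm)
  then show ?thesis using False by simp
qed

text \<open>Substituting \<open>c = a b\<close> in the double sum gives the fibre sum of
  \<open>f a * augmentation h (src G a)\<close>; hence the kernel of the augmentation absorbs
  multiplication from the left.\<close>

lemma augmentation_convolution_zero:
  assumes f: "rng_finite f" and h: "rng_finite h" and "\<And>y. augmentation h y = 0"
  shows "augmentation (convolution G f h) x = 0"
proof -
  let ?A = "{a. rng G a = x \<and> f a \<noteq> 0}"
  define C where "C = (\<Union>a\<in>?A. cmp G a ` {b. rng G b = src G a \<and> h b \<noteq> 0})"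
  have fA: "finite ?A" and fC: "finite C" using f h by (auto simp: rng_finite_def C_def)
  have rC: "rng G c = x" if "c \<in> C" for c using that by (auto simp: gsimps C_def)
  have "augmentation (convolution G f h) x = (\<Sum>c\<in>C. convolution G f h c)"
  proof (rule augmentation_eq[OF fC rC])
    fix c assume c: "rng G c = x" "convolution G f h c \<noteq> 0"
    then obtain a where a: "rng G a = rng G c" "f a * h (cmp G (ginv G a) c) \<noteq> 0"
      unfolding convolution_rng_finite[OF f] by (auto elim: sum.not_neutral_contains_not_neutral)
    then have "f a \<noteq> 0" "h (cmp G (ginv G a) c) \<noteq> 0" by auto
    then show "c \<in> C" unfolding C_def
      using a(1) c(1) by (intro UN_I[of a] image_eqI[of _ _ "cmp G (ginv G a) c"]) (auto simp: gsimps)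
  qed
  also have "\<dots> = (\<Sum>c\<in>C. \<Sum>a\<in>?A. f a * h (cmp G (ginv G a) c))"
    by (rule sum.cong) (auto simp: convolution_rng_finite[OF f] rC)
  also have "\<dots> = (\<Sum>a\<in>?A. \<Sum>c\<in>C. f a * h (cmp G (ginv G a) c))"
    by (rule sum.swap)
  also have "\<dots> = (\<Sum>a\<in>?A. f a * (\<Sum>c\<in>C. h (cmp G (ginv G a) c)))"
    by (simp add: sum_distrib_left)
  also have "\<dots> = (\<Sum>a\<in>?A. f a * augmentation h (src G a))"
  proof (intro sum.cong refl)
    fix a assume a: "a \<in> ?A"
    let ?B = "cmp G (ginv G a) ` C"
    have inj: "inj_on (cmp G (ginv G a)) C"
      by (rule inj_on_inverseI[of _ "cmp G a"]) (use a rC in \<open>simp add: gsimps\<close>)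
    have "augmentation h (src G a) = (\<Sum>b\<in>?B. h b)"
    proof (rule augmentation_eq)
      show "finite ?B" using fC by blast
      show "rng G b = src G a" if "b \<in> ?B" for b
        using that a rC by (auto simp: gsimps)
      show "b \<in> ?B" if "rng G b = src G a" "h b \<noteq> 0" for b
        using that a by (intro image_eqI[of _ _ "cmp G a b"]) (auto simp: gsimps C_def)
    qed
    also have "\<dots> = (\<Sum>c\<in>C. h (cmp G (ginv G a) c))"
      by (subst sum.reindex[OF inj]) simp
    finally show "f a * (\<Sum>c\<in>C. h (cmp G (ginv G a) c)) = f a * augmentation h (src G a)" by simp
  qed
  also have "\<dots> = 0" using assms(3) by simp
  finally show ?thesis .
qed

end

section \<open>The three conditions forced by regularity\<close>

context ample_groupoid
begin

text \<open>For a set \<open>U\<close> of units, \<open>?f\<close> acts on both sides as scaling by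
  \<open>c\<close> over \<open>U\<close>, so evaluating the regularity identity at \<open>x\<close>
  leaves an identity in the coefficient ring.\<close>

lemma coefficients_regular:
  assumes "von_neumann_regular (groupoid_algebra G :: ('a \<Rightarrow> 'r::ring_1) set) (convolution G)"
  shows "von_neumann_regular (UNIV :: 'r set) (*)"
  unfolding von_neumann_regular_def
proof (rule ballI)
  fix c :: 'r
  obtain x where x: "x \<in> units_of_groupoid G" using src_unit by blast
  obtain U where U: "U \<in> compact_bisections G" "x \<in> U" "U \<subseteq> units_of_groupoid G"
    using compact_bisections_basis[OF open_units x] by blast
  let ?f = "\<lambda>a. c * indicator U a"
  obtain b where b: "convolution G (convolution G ?f b) ?f = ?f"
    using assms groupoid_algebra_indicator[OF U(1)] unfolding von_neumann_regular_def by blast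
  have "convolution G (convolution G ?f b) ?f x = c * b x * c"
    using U x[unfolded unit_iff] x[unfolded unit_iff']
    by (simp add: convolution_unit_indicator_left convolution_unit_indicator_right)
  then have "c * b x * c = c" using U(2) by (simp add: b)
  then show "\<exists>d\<in>UNIV. c * d * c = c" by blast
qed

text \<open>At \<open>x\<close>, the product of \<open>f\<close>, \<open>b\<close> and
  \<open>f\<close> is a double sum over \<open>H\<close> in which each value \<open>b k\<close> with
  \<open>k\<close> in \<open>H\<close> occurs \<open>card H\<close> times, while \<open>f x\<close>
  is one.\<close>

lemma isotropy_order_invertible:
  assumes reg: "von_neumann_regular (groupoid_algebra G :: ('a \<Rightarrow> 'r::ring_1) set) (convolution G)"
    and x: "x \<in> units_of_groupoid G" and H: "subgroup H (isotropy_group G x)" and finH: "finite H"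
  shows "ring_invertible (of_nat (card H) :: 'r)"
proof -
  have H1: "src G h = x" "rng G h = x" if "h \<in> H" for h
    using subgroup.mem_carrier[OF H that] by (auto simp: isotropy_group_def)
  have H2: "cmp G h k \<in> H" if "h \<in> H" "k \<in> H" for h k
    using subgroup.m_closed[OF H that] by (simp add: isotropy_group_def)
  have H3: "ginv G h \<in> H" if "h \<in> H" for h
    using subgroup.m_inv_closed[OF H that] inv_isotropy_group[OF x subgroup.mem_carrier[OF H that]] by simp
  have H4: "x \<in> H" using subgroup.one_closed[OF H] by (simp add: isotropy_group_def)
  have "\<exists>U. U \<in> compact_bisections G \<and> h \<in> U" for h
    using compact_bisections_basis[of UNIV h] by auto
  then obtain U where U: "U h \<in> compact_bisections G" "h \<in> U h" for h by metis
  have inj: "inj_on (rng G) (U h)" "inj_on (src G) (U h)" for h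
    using U(1)[of h] by (auto simp: compact_bisections_iff)
  \<comment> \<open>The factor 1 keeps the shape \<open>c * indicator U a\<close> to which the
    lemmas on indicators apply; the same device recurs below.\<close>
  define f :: "'a \<Rightarrow> 'r" where "f = (\<lambda>a. \<Sum>h\<in>H. 1 * indicator (U h) a)"
  have fGA: "f \<in> groupoid_algebra G"
    unfolding f_def by (intro groupoid_algebra_sum groupoid_algebra_indicator U finH)
  \<comment> \<open>An arrow of \<open>U h\<close> that shares its range or its source with
    \<open>h\<close> equals \<open>h\<close>, so on arrows starting or ending at \<open>x\<close>
    the function \<open>f\<close> is the indicator of \<open>H\<close>.\<close>
  have f_eq: "f a = (if a \<in> H then 1 else 0)" if a: "rng G a = x \<or> src G a = x" for a
  proof -
    have "a \<in> U h \<longleftrightarrow> a = h" if "h \<in> H" for h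
    proof
      assume aU: "a \<in> U h"
      from a show "a = h"
      proof
        assume "rng G a = x"
        then show ?thesis using H1[OF that] by (intro inj_onD[OF inj(1) _ aU U(2)]) simp
      next
        assume "src G a = x"
        then show ?thesis using H1[OF that] by (intro inj_onD[OF inj(2) _ aU U(2)]) simp
      qed
    qed (use U in auto)
    then have "f a = (\<Sum>h\<in>H. if h = a then 1 else 0)"
      unfolding f_def by (intro sum.cong refl) auto
    then show ?thesis using finH by simp
  qed
  obtain b where b: "convolution G (convolution G f b) f = f"
    using reg fGA unfolding von_neumann_regular_def by blast
  define c where "c = (\<Sum>k\<in>H. b k)"
  have "convolution G f b (ginv G g) = c" if g: "g \<in> H" for g
  proof -
    have "convolution G f b (ginv G g) = (\<Sum>a\<in>H. f a * b (cmp G (ginv G a) (ginv G g)))"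
    proof (rule convolution_eq_left[OF finH])
      show "rng G a = rng G (ginv G g)" if "a \<in> H" for a
        using H1 that g by (simp add: gsimps)
      show "a \<in> H" if a: "rng G a = rng G (ginv G g)" "f a * b (cmp G (ginv G a) (ginv G g)) \<noteq> 0" for a
      proof -
        have "rng G a = x" using a(1) H1[OF g] by (simp add: gsimps)
        moreover have "f a \<noteq> 0" using a(2) by auto
        ultimately show ?thesis using f_eq[of a] by (auto split: if_splits)
      qed
    qed
    also have "\<dots> = (\<Sum>a\<in>H. b (cmp G (ginv G a) (ginv G g)))"
      by (rule sum.cong) (auto simp: f_eq H1)
    \<comment> \<open>The map \<open>a \<mapsto> cmp G (ginv G a) (ginv G g)\<close> permutes the
      group \<open>H\<close>, so the value does not depend on \<open>g\<close>.\<close>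
    also have "\<dots> = c" unfolding c_def
    proof (rule sum.reindex_bij_witness[where i = "\<lambda>k. cmp G (ginv G g) (ginv G k)"
          and j = "\<lambda>a. cmp G (ginv G a) (ginv G g)"])
      fix a assume a: "a \<in> H"
      then have sr: "src G a = x" "rng G a = x" "src G g = x" "rng G g = x" using H1 g by auto
      then show "cmp G (ginv G g) (ginv G (cmp G (ginv G a) (ginv G g))) = a"
        "cmp G (ginv G (cmp G (ginv G g) (ginv G a))) (ginv G g) = a"
        by (simp_all add: gsimps)
      show "cmp G (ginv G a) (ginv G g) \<in> H" "cmp G (ginv G g) (ginv G a) \<in> H"
        using a g H2 H3 by auto
    qed simp
    finally show ?thesis .
  qed
  moreover have "convolution G (convolution G f b) f x =
      (\<Sum>g\<in>H. convolution G f b (cmp G x (ginv G g)) * f g)"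
  proof (rule convolution_eq_right[OF finH])
    have sx: "src G x = x" using x unit_iff by blast
    show "src G g = src G x" if "g \<in> H" for g using H1 that sx by simp
    show "g \<in> H" if g: "src G g = src G x" "convolution G f b (cmp G x (ginv G g)) * f g \<noteq> 0" for g
    proof -
      have "f g \<noteq> 0" using g(2) by auto
      then show ?thesis using f_eq[of g] g(1) sx by (auto split: if_splits)
    qed
  qed
  moreover have "\<dots> = (\<Sum>g\<in>H. convolution G f b (ginv G g))"
    by (rule sum.cong) (auto simp: f_eq H1 gsimps)
  ultimately have "of_nat (card H) * c = f x" by (simp add: b)
  then have "of_nat (card H) * c = 1" using f_eq[of x] H4 x unit_iff by auto
  moreover have "c * of_nat (card H) = of_nat (card H) * c" by (metis mult_of_nat_commute)
  ultimately show ?thesis unfolding ring_invertible_def by metis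
qed

text \<open>
  If \<open>e\<close> is a right unit for \<open>X\<close> and \<open>y z y = y\<close> where \<open>y = f - f e\<close>, then \<open>e + z y - e z y\<close> is a right unit for
  \<open>insert f X\<close>; the augmentation condition records membership in the left ideal.
\<close>

lemma common_right_unit:
  assumes reg: "von_neumann_regular (groupoid_algebra G :: ('a \<Rightarrow> 'r::ring_1) set) (convolution G)"
    and "finite X" and "X \<subseteq> (groupoid_algebra G :: ('a \<Rightarrow> 'r) set)"
    and "\<And>f y. f \<in> X \<Longrightarrow> augmentation f y = 0"
  shows "\<exists>e\<in>groupoid_algebra G. (\<forall>y. augmentation e y = 0) \<and> (\<forall>f\<in>X. convolution G f e = f)"
  using assms(2-4)
proof (induction X rule: finite_induct)
  case empty
  show ?case
    by (intro bexI[of _ "\<lambda>_. 0"]) (auto simp: augmentation_def groupoid_algebra_zero)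
next
  case (insert f X)
  then obtain e where e: "e \<in> groupoid_algebra G" "\<And>y. augmentation e y = 0"
    "\<And>g. g \<in> X \<Longrightarrow> convolution G g e = g" by (metis insert_subset insertI2)
  have f: "f \<in> groupoid_algebra G" "\<And>y. augmentation f y = 0" using insert.prems by auto
  note rf = groupoid_algebra_rng_finite
  define y where "y = (\<lambda>x. f x - convolution G f e x)"
  have y: "y \<in> groupoid_algebra G" unfolding y_def
    by (intro groupoid_algebra_diff groupoid_algebra_convolution f e)
  have augy: "augmentation y z = 0" for z
    unfolding y_def using f e
    by (simp add: augmentation_diff augmentation_convolution_zero rf groupoid_algebra_convolution)
  obtain z where z: "z \<in> groupoid_algebra G" "convolution G (convolution G y z) y = y"
    using reg y unfolding von_neumann_regular_def by blast
  define w where "w = convolution G z y"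
  have w: "w \<in> groupoid_algebra G" "\<And>t. augmentation w t = 0"
    unfolding w_def using z y augy
    by (auto simp: groupoid_algebra_convolution augmentation_convolution_zero rf)
  have yw: "convolution G y w = y" unfolding w_def
    using z(2) convolution_assoc[OF rf[OF y] rf[OF z(1)], of y] by simp
  define v where "v = convolution G e w"
  have v: "v \<in> groupoid_algebra G" "\<And>t. augmentation v t = 0"
    unfolding v_def using e w
    by (auto simp: groupoid_algebra_convolution augmentation_convolution_zero rf)
  let ?e = "\<lambda>x. e x + (w x - v x)"
  have conv: "convolution G g ?e = (\<lambda>x. convolution G g e x +
      (convolution G g w x - convolution G (convolution G g e) w x))"
    if g: "g \<in> groupoid_algebra G" for g
    using convolution_assoc[OF rf[OF g] rf[OF e(1)], of w]
    by (simp add: convolution_add_right[OF rf[OF g]] convolution_diff_right[OF rf[OF g]] v_def)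
  have "convolution G g ?e = g" if "g \<in> X" for g
    using that conv[of g] e(3)[OF that] insert.prems(1) by auto
  moreover have "convolution G f ?e = f"
  proof -
    \<comment> \<open>The left side is the convolution of \<open>y\<close> with \<open>w\<close>,
      and \<open>w\<close> is a right unit for \<open>y\<close>. For members of \<open>X\<close> the
      analogous difference cancels, because \<open>e\<close> already fixes them.\<close>
    have "(\<lambda>x. convolution G f w x - convolution G (convolution G f e) w x) = y"
      using yw unfolding y_def
      by (simp add: convolution_diff_left rf f e groupoid_algebra_convolution)
    then have "convolution G f ?e = (\<lambda>x. convolution G f e x + y x)"
      by (simp add: conv[OF f(1)] fun_eq_iff)
    then show ?thesis by (simp add: y_def)
  qed
  moreover have "?e \<in> groupoid_algebra G"
    by (intro groupoid_algebra_add groupoid_algebra_diff e w v)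
  moreover have "augmentation ?e t = 0" for t
    using e w v by (simp add: augmentation_add augmentation_diff rf groupoid_algebra_diff)
  ultimately show ?case by blast
qed

text \<open>The required subgroupoid is \<open>W N\<close>: the words of length at most
  \<open>N\<close> in a symmetric set \<open>P\<close> containing \<open>C\<close>, where
  \<open>N\<close> bounds the support of the invariant element \<open>p\<close> in every source
  fibre.\<close>

lemma compact_generation:
  assumes reg: "von_neumann_regular (groupoid_algebra G :: ('a \<Rightarrow> 'r::ring_1) set) (convolution G)"
    and C: "compact C" "C \<noteq> {}"
  shows "\<exists>H. subgroupoid G H \<and> open H \<and> compact H \<and> C \<subseteq> H"
proof -
  obtain \<U> where \<U>: "finite \<U>" "\<U> \<subseteq> compact_bisections G" "C \<subseteq> \<Union>\<U>"
    using compact_cover_bisections[OF C(1) open_UNIV] by auto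
  have oU: "open U" and cU: "compact U" and injU: "inj_on (rng G) U" if "U \<in> \<U>" for U
    using \<U>(2) that by (auto simp: compact_bisections_iff)
  define P0 where "P0 = \<Union>\<U>"
  have P0: "open P0" "compact P0"
    using oU cU \<U>(1) by (auto simp: P0_def)
  have P0_ne: "P0 \<noteq> {}" using \<U>(3) C(2) by (auto simp: P0_def)
  \<comment> \<open>All units touched by the cover; \<open>indicator K\<close> serves as a local
    identity for the elements of \<open>X\<close>.\<close>
  define K where "K = rng G ` P0 \<union> src G ` P0"
  have K: "open K" "compact K" "K \<subseteq> units_of_groupoid G" "K \<noteq> {}"
    using P0 P0_ne by (auto simp: K_def open_Un compact_Un open_rng_image open_src_image
        compact_rng_image compact_src_image)
  have Kcb: "K \<in> compact_bisections G" by (rule compact_bisections_units[OF K(1-3)])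
  have Ku: "src G x = x" "rng G x = x" if "x \<in> K" for x
    using that K(3) unit_iff unit_iff' by auto
  \<comment> \<open>Closing under inverses makes the set of all words a subgroupoid; including the
    units in \<open>K\<close> makes the word sets increase with the length.\<close>
  define P where "P = P0 \<union> ginv G ` P0 \<union> K"
  have P: "open P" "compact P"
    using P0 K by (auto simp: P_def open_Un compact_Un open_ginv_image compact_ginv_image)
  have PK: "rng G u \<in> K" "src G u \<in> K" if u: "u \<in> P" for u
  proof -
    consider "u \<in> P0" | v where "v \<in> P0" "u = ginv G v" | "u \<in> K"
      using u by (auto simp: P_def)
    then have "rng G u \<in> K \<and> src G u \<in> K"
      by cases (auto simp: K_def gsimps)
    then show "rng G u \<in> K" "src G u \<in> K" by auto
  qed
  have Pinv: "ginv G u \<in> P" if "u \<in> P" for u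
    using that K(3) ginv_unit by (auto simp: P_def gsimps)

  note rf = groupoid_algebra_rng_finite
  define X :: "('a \<Rightarrow> 'r) set" where
    "X = (\<lambda>U x. 1 * indicator U x - 1 * indicator (rng G ` U) x) ` \<U>"
  have X_GA: "X \<subseteq> groupoid_algebra G"
    using \<U>(2) by (auto simp: X_def intro!: groupoid_algebra_diff groupoid_algebra_indicator
        compact_bisections_rng simp del: mult_1_left)
  have "augmentation f y = 0" if fX: "f \<in> X" for f y
  proof -
    obtain U where U: "U \<in> \<U>" "f = (\<lambda>x. 1 * indicator U x - 1 * indicator (rng G ` U) x)"
      using fX unfolding X_def by (elim imageE) (rule that)
    have inj: "inj_on (rng G) (rng G ` U)" by (auto simp: inj_on_def gsimps)
    show ?thesis unfolding U(2)
      by (subst augmentation_diff)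
        (simp_all only: rng_finite_indicator injU[OF U(1)] inj augmentation_indicator image_image
          rng_rng diff_self)
  qed
  then obtain e where e: "e \<in> groupoid_algebra G" "\<And>y. augmentation e y = 0"
    "\<And>f. f \<in> X \<Longrightarrow> convolution G f e = f"
    using common_right_unit[OF reg _ X_GA] \<U>(1) by (force simp: X_def)
  define p :: "'a \<Rightarrow> 'r" where "p = (\<lambda>x. 1 * indicator K x - e x)"
  have p: "p \<in> groupoid_algebra G"
    unfolding p_def by (intro groupoid_algebra_diff groupoid_algebra_indicator Kcb e)
  \<comment> \<open>The element \<open>f\<close> has its support over sources in \<open>K\<close>,
    so multiplying it by \<open>indicator K\<close> on the right changes nothing, and neither does
    multiplying by \<open>e\<close>. Hence \<open>f\<close> annihilates \<open>p\<close>; at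
    \<open>c\<close> this says that translating by \<open>ginv G u\<close> preserves the value of
    \<open>p\<close>.\<close>
  have p0: "p (cmp G (ginv G u) c) = p c" if u: "u \<in> P0" "rng G c = rng G u" for u c
  proof -
    obtain U where U: "U \<in> \<U>" "u \<in> U" using u by (auto simp: P0_def)
    let ?V = "rng G ` U"
    have Vu: "?V \<subseteq> units_of_groupoid G" by auto
    have inj: "inj_on (rng G) ?V" by (auto simp: inj_on_def gsimps)
    define f :: "'a \<Rightarrow> 'r" where "f = (\<lambda>x. 1 * indicator U x - 1 * indicator ?V x)"
    have fX: "f \<in> X" using U(1) by (auto simp: X_def f_def)
    then have f: "f \<in> groupoid_algebra G" using X_GA by blast
    have fK: "f a = 0" if "src G a \<notin> K" for a
    proof -
      have "a \<notin> U" using that U(1) by (auto simp: K_def P0_def)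
      moreover have "a \<notin> ?V"
        using that U(1) Ku(1)[of a] by (auto simp: K_def P0_def)
      ultimately show ?thesis by (simp add: f_def)
    qed
    have "convolution G f p = (\<lambda>x. convolution G f (\<lambda>a. 1 * indicator K a) x - convolution G f e x)"
      unfolding p_def by (rule convolution_diff_right[OF rf[OF f]])
    also have "\<dots> = (\<lambda>x. 0)"
    proof
      fix a
      show "convolution G f (\<lambda>a. 1 * indicator K a) a - convolution G f e a = 0"
        unfolding convolution_unit_indicator_right[OF K(3)] e(3)[OF fX]
        using fK[of a] by (cases "src G a \<in> K") auto
    qed
    finally have "convolution G f p c = 0" by simp
    moreover have "convolution G f p c = 1 * p (cmp G (ginv G u) c) - 1 * indicator ?V (rng G c) * p c"
      unfolding f_def
      by (simp only: convolution_diff_left[OF rng_finite_indicator[OF injU[OF U(1)]] rng_finite_indicator[OF inj]]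
          convolution_indicator_left[OF injU[OF U(1)] U(2) u(2)[symmetric]]
          convolution_unit_indicator_left[OF Vu])
    moreover have "rng G c \<in> ?V" using U(2) u(2) by auto
    ultimately show ?thesis by simp
  qed
  have p1: "p (cmp G u c) = p c" if u: "u \<in> P" "src G u = rng G c" for u c
  proof -
    consider "u \<in> P0" | v where "v \<in> P0" "u = ginv G v" | "u \<in> K"
      using u(1) by (auto simp: P_def)
    then show ?thesis
    proof cases
      case 1
      then show ?thesis using p0[of u "cmp G u c"] u(2) by (simp add: gsimps)
    next
      case 2
      then show ?thesis using p0[of v c] u(2) by (simp add: gsimps)
    next
      case 3
      then show ?thesis using u(2) Ku by (simp add: gsimps)
    qed
  qed
  \<comment> \<open>The augmentation of \<open>p\<close> is that of \<open>indicator K\<close>,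
    hence 1 over every unit of \<open>K\<close>, and 1 differs from 0 in the coefficient
    ring.\<close>
  have pne: "\<exists>c. rng G c = x \<and> p c \<noteq> 0" if x: "x \<in> K" for x
  proof (rule ccontr)
    assume "\<nexists>c. rng G c = x \<and> p c \<noteq> 0"
    then have "augmentation p x = 0" unfolding augmentation_def by (intro sum.neutral) auto
    moreover have "augmentation p x = 1 * indicator (rng G ` K) x - augmentation e x"
    proof -
      have inj: "inj_on (rng G) K" using Kcb by (simp add: compact_bisections_iff)
      show ?thesis unfolding p_def
        by (simp only: augmentation_diff[OF rng_finite_indicator[OF inj] rf[OF e(1)]]
            augmentation_indicator[OF inj])
    qed
    moreover have "x \<in> rng G ` K" using x Ku by force
    ultimately show False using e(2) by simp
  qed

  \<comment> \<open>Words with \<open>n\<close> letters from \<open>P\<close>, starting from the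
    units in \<open>K\<close> as empty words.\<close>
  define W where "W n = (gprod P ^^ n) K" for n
  have W0: "W 0 = K" and WS: "W (Suc n) = gprod P (W n)" for n by (simp_all add: W_def)
  have Woc: "open (W n) \<and> compact (W n)" for n
    by (induction n) (use K P in \<open>auto simp: W0 WS open_gprod compact_gprod\<close>)
  have WK: "src G h \<in> K \<and> rng G h \<in> K" if "h \<in> W n" for h n
    using that
  proof (induction n arbitrary: h)
    case 0
    then show ?case by (simp add: W0 Ku)
  next
    case (Suc n)
    then obtain u w where "u \<in> P" "w \<in> W n" "src G u = rng G w" "h = cmp G u w"
      unfolding WS by (auto elim: gprodE)
    then show ?case using Suc.IH[of w] PK[of u] by (simp add: gsimps)
  qed
  have W_mono1: "W n \<subseteq> W (Suc n)" for n
  proof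
    fix h assume h: "h \<in> W n"
    have "rng G h \<in> P" using WK[OF h] by (simp add: P_def)
    then have "cmp G (rng G h) h \<in> W (Suc n)"
      unfolding WS by (rule gprodI[OF _ h]) (simp add: gsimps)
    then show "h \<in> W (Suc n)" by (simp add: gsimps)
  qed
  then have W_mono: "mono W" by (simp add: mono_iff_le_Suc)
  have pW: "p (cmp G h c) = p c" if "h \<in> W n" "src G h = rng G c" for h n c
    using that
  proof (induction n arbitrary: h)
    case 0
    then show ?case using Ku[of h] by (simp add: W0 gsimps)
  next
    case (Suc n)
    then obtain u w where *: "u \<in> P" "w \<in> W n" "src G u = rng G w" "h = cmp G u w"
      unfolding WS by (auto elim: gprodE)
    then have "src G w = rng G c" using Suc.prems by (simp add: gsimps)
    then show ?case using Suc.IH[of w] p1[of u "cmp G w c"] * by (simp add: gsimps)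
  qed
  obtain N where N: "\<And>x. finite {a. src G a = x \<and> p a \<noteq> 0}"
    "\<And>x. card {a. src G a = x \<and> p a \<noteq> 0} \<le> N"
    using groupoid_algebra_src_fibre_card[OF p] by blast

  have W_stable: "W n \<subseteq> W N" for n
  proof
    fix h assume h: "h \<in> W n"
    define x where "x = src G h"
    have xK: "x \<in> K" using WK[OF h] by (simp add: x_def)
    define S where "S n = {a \<in> W n. src G a = x}" for n
    let ?S = "\<Union>n. S n"
    \<comment> \<open>Right translation by this one arrow injects all words with source
      \<open>x\<close> into the support of \<open>p\<close> over the source of \<open>c\<close>, by
      invariance of \<open>p\<close>; that support has at most \<open>N\<close> elements.\<close>
    obtain c where c: "rng G c = x" "p c \<noteq> 0" using pne[OF xK] by blast
    have inj: "inj_on (\<lambda>a. cmp G a c) ?S"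
      by (rule inj_on_inverseI[of _ "\<lambda>a. cmp G a (ginv G c)"]) (auto simp: S_def c gsimps)
    have sub: "(\<lambda>a. cmp G a c) ` ?S \<subseteq> {a. src G a = src G c \<and> p a \<noteq> 0}"
      using c pW by (auto simp: S_def gsimps)
    have fin: "finite ?S" using inj_on_finite[OF inj sub N(1)] .
    have card: "card ?S \<le> N"
      using card_inj_on_le[OF inj sub N(1)] N(2)[of "src G c"] by linarith
    \<comment> \<open>Since \<open>S (Suc n)\<close> is computed from \<open>S n\<close> alone, the
      increasing chain is constant after its first repetition. Every earlier step adds an element,
      so all words from \<open>x\<close> are reached by stage \<open>card ?S\<close>.\<close>
    have S_Suc: "S (Suc n) = {cmp G u w | u w. u \<in> P \<and> w \<in> S n \<and> src G u = rng G w}" for n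
      by (auto simp: S_def WS gprod_def gsimps) (blast intro: sym)
    have "finite (range S)"
      by (rule finite_subset[of _ "Pow ?S"]) (use fin in auto)
    moreover have "mono S" using W_mono by (auto simp: mono_def S_def)
    moreover have "\<forall>n. S n = S (Suc n) \<longrightarrow> S (Suc n) = S (Suc (Suc n))"
      by (simp add: S_Suc)
    ultimately have "S (card ?S) = ?S"
      by (intro finite_mono_strict_prefix_implies_finite_fixpoint
          finite_mono_remains_stable_implies_strict_prefix fin) auto
    then have "h \<in> S (card ?S)" using h by (auto simp: S_def x_def)
    then show "h \<in> W N" using monoD[OF W_mono card] by (auto simp: S_def)
  qed
  have W_cmp: "cmp G h k \<in> W (n + m)" if "h \<in> W n" "k \<in> W m" "src G h = rng G k" for h k n m
    using that
  proof (induction n arbitrary: h)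
    case 0
    then show ?case using Ku[of h] by (simp add: W0 gsimps)
  next
    case (Suc n)
    then obtain u w where *: "u \<in> P" "w \<in> W n" "src G u = rng G w" "h = cmp G u w"
      unfolding WS by (auto elim: gprodE)
    then have "src G w = rng G k" using Suc.prems by (simp add: gsimps)
    then have "cmp G u (cmp G w k) \<in> W (Suc (n + m))"
      unfolding WS using * Suc.IH[of w] Suc.prems by (intro gprodI) (auto simp: gsimps)
    then show ?case using * \<open>src G w = rng G k\<close> by (simp add: gsimps)
  qed
  have PW: "u \<in> W 1" if "u \<in> P" for u
  proof -
    have "cmp G u (src G u) \<in> W (Suc 0)"
      unfolding WS W0 by (intro gprodI that PK) (simp add: gsimps)
    then show ?thesis by (simp add: gsimps)
  qed
  \<comment> \<open>Some length \<open>m\<close> suffices here, because \<open>W_stable\<close>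
    places every \<open>W m\<close> inside \<open>W N\<close>.\<close>
  have W_inv: "\<exists>m. ginv G h \<in> W m" if "h \<in> W n" for h n
    using that
  proof (induction n arbitrary: h)
    case 0
    then have "ginv G h \<in> W 0" using K(3) ginv_unit by (auto simp: W0)
    then show ?case by blast
  next
    case (Suc n)
    then obtain u w where *: "u \<in> P" "w \<in> W n" "src G u = rng G w" "h = cmp G u w"
      unfolding WS by (auto elim: gprodE)
    obtain m where "ginv G w \<in> W m" using Suc.IH[OF *(2)] by blast
    then have "cmp G (ginv G w) (ginv G u) \<in> W (m + 1)"
      using PW[OF Pinv[OF *(1)]] *(3) by (intro W_cmp) (auto simp: gsimps)
    then show ?case using * by (auto simp: gsimps)
  qed
  have "subgroupoid G (W N)"
    unfolding subgroupoid_def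
  proof (intro conjI ballI impI)
    show "W N \<noteq> {}" using W_stable[of 0] K(4) W0 by auto
    show "ginv G a \<in> W N" if "a \<in> W N" for a using W_inv[OF that] W_stable by blast
    show "cmp G a b \<in> W N" if "a \<in> W N" "b \<in> W N" "src G a = rng G b" for a b
      using W_cmp[OF that] W_stable by blast
  qed
  moreover have "C \<subseteq> W N" using \<U>(3) PW W_stable[of 1] by (auto simp: P_def P0_def)
  ultimately show ?thesis using Woc by blast
qed

text \<open>The family of all compact open subgroupoids works: \<open>compact_generation\<close>
  applied to singletons shows that it covers, and applied to the union of two members it gives
  directedness.\<close>

lemma directed_union_of_compact_subgroupoids:
  assumes reg: "von_neumann_regular (groupoid_algebra G :: ('a \<Rightarrow> 'r::ring_1) set) (convolution G)"
  shows "directed_union_of (\<lambda>H. subgroupoid G H \<and> open H \<and> compact H) UNIV"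
proof -
  let ?D = "{H. subgroupoid G H \<and> open H \<and> compact H}"
  have pt: "\<exists>H\<in>?D. x \<in> H" for x
    using compact_generation[OF reg, of "{x}"] by auto
  have "\<exists>L\<in>?D. H \<subseteq> L \<and> K \<subseteq> L" if "H \<in> ?D" "K \<in> ?D" for H K
  proof -
    have "compact (H \<union> K)" "H \<union> K \<noteq> {}"
      using that by (auto simp: compact_Un subgroupoid_def)
    then show ?thesis using compact_generation[OF reg, of "H \<union> K"] by auto
  qed
  moreover have "?D \<noteq> {}" using pt by blast
  moreover have "\<Union>?D = UNIV" using pt by blast
  ultimately show ?thesis unfolding directed_union_of_def
    by (intro exI[of _ ?D]) simp
qed

end

subsection \<open>Sufficiency\<close>

text \<open>This is the fact that a finitely generated left ideal contains a right unit for itself: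
  \<open>\<Sum>l\<in>I. w l * u l\<close> is that unit.\<close>

lemma column_regular:
  fixes u :: "'i \<Rightarrow> 'r::ring_1"
  assumes reg: "von_neumann_regular (UNIV :: 'r set) (*)" and "finite I"
  shows "\<exists>w. \<forall>i\<in>I. u i * (\<Sum>l\<in>I. w l * u l) = u i"
  using assms(2)
proof (induction I rule: finite_induct)
  case empty
  show ?case by simp
next
  case (insert p I)
  then obtain w where w: "\<And>i. i \<in> I \<Longrightarrow> u i * (\<Sum>l\<in>I. w l * u l) = u i" by blast
  define s where "s = (\<Sum>l\<in>I. w l * u l)"
  define r where "r = u p - u p * s"
  obtain t where t: "r * t * r = r" using reg unfolding von_neumann_regular_def by blast
  \<comment> \<open>The new right unit is \<open>s + z * r\<close>, the same correction as in
    \<open>common_right_unit\<close>. Expanding \<open>r\<close> yields the coefficients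
    \<open>v\<close>.\<close>
  define z where "z = t - s * t"
  define v where "v l = (if l = p then z else w l - z * u p * w l)" for l
  have "(\<Sum>l\<in>insert p I. v l * u l) = z * u p + (\<Sum>l\<in>I. w l * u l - z * u p * (w l * u l))"
    using insert.hyps by (auto simp: v_def algebra_simps intro!: sum.cong)
  also have "\<dots> = s + z * r"
    by (simp add: sum_subtractf s_def r_def algebra_simps flip: sum_distrib_left)
  finally have sum: "(\<Sum>l\<in>insert p I. v l * u l) = s + z * r" .
  have "u i * (s + z * r) = u i" if "i \<in> insert p I" for i
  proof (cases "i = p")
    case True
    have "u p * (s + z * r) = u p * s + r * t * r" by (simp add: z_def r_def algebra_simps)
    then show ?thesis using True t by (simp add: r_def)
  next
    case False
    then have us: "u i * s = u i" using w that by (simp add: s_def)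
    have "u i * (s + z * r) = u i * s + (u i * t - (u i * s) * t) * r"
      by (simp add: z_def algebra_simps)
    then show ?thesis by (simp add: us)
  qed
  then show ?case by (metis sum)
qed

text \<open>A matrix \<open>T\<close> with \<open>F T F = F\<close> is built by adding one column of
  \<open>F\<close> at a time; only the column case uses regularity of the ring.\<close>

lemma matrix_regular:
  fixes F :: "'i \<Rightarrow> 'j \<Rightarrow> 'r::ring_1"
  assumes reg: "von_neumann_regular (UNIV :: 'r set) (*)" and I: "finite I" and "finite J"
  shows "\<exists>T. \<forall>i\<in>I. \<forall>j\<in>J. (\<Sum>l\<in>I. (\<Sum>k\<in>J. F i k * T k l) * F l j) = F i j"
  using assms(3)
proof (induction J rule: finite_induct)
  case empty
  show ?case by simp
next
  case (insert q J)
  then obtain T where T: "\<And>i j. i \<in> I \<Longrightarrow> j \<in> J \<Longrightarrow> (\<Sum>l\<in>I. (\<Sum>k\<in>J. F i k * T k l) * F l j) = F i j"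
    by blast
  define E where "E i l = (\<Sum>k\<in>J. F i k * T k l)" for i l
  \<comment> \<open>The matrix \<open>E\<close> already fixes the columns in \<open>J\<close>, and
    \<open>u\<close> is the part of the new column that it misses.\<close>
  define u where "u i = F i q - (\<Sum>l\<in>I. E i l * F l q)" for i
  obtain w where w: "\<And>i. i \<in> I \<Longrightarrow> u i * (\<Sum>l\<in>I. w l * u l) = u i"
    using column_regular[OF reg I, of u] by blast
  \<comment> \<open>As a row, \<open>z = w (1 - E)\<close>: it kills the columns in \<open>J\<close>
    and has the same product with column \<open>q\<close> as \<open>w\<close> has with
    \<open>u\<close>.\<close>
  define z where "z l = w l - (\<Sum>i\<in>I. w i * E i l)" for l
  \<comment> \<open>Chosen so that \<open>F T' = E + u z\<close>. On old columns the second term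
    vanishes, and on column \<open>q\<close> it contributes exactly the missing part
    \<open>u\<close>.\<close>
  define T' where "T' k l = (if k = q then z l else T k l - (\<Sum>i\<in>I. T k i * F i q) * z l)" for k l
  have FT: "(\<Sum>k\<in>insert q J. F i k * T' k l) = E i l + u i * z l" for i l
  proof -
    have "(\<Sum>k\<in>J. F i k * T' k l) = (\<Sum>k\<in>J. F i k * T k l - F i k * (\<Sum>i\<in>I. T k i * F i q) * z l)"
      using insert.hyps by (intro sum.cong) (auto simp: T'_def algebra_simps)
    also have "\<dots> = E i l - (\<Sum>k\<in>J. F i k * (\<Sum>i\<in>I. T k i * F i q)) * z l"
      by (simp add: sum_subtractf E_def sum_distrib_right)
    also have "(\<Sum>k\<in>J. F i k * (\<Sum>i\<in>I. T k i * F i q)) = (\<Sum>l\<in>I. E i l * F l q)"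
      unfolding E_def sum_distrib_left sum_distrib_right
      by (subst sum.swap) (simp add: mult.assoc)
    finally show ?thesis
      using insert.hyps by (simp add: T'_def u_def algebra_simps)
  qed
  have zF: "(\<Sum>l\<in>I. z l * F l j) = (\<Sum>l\<in>I. w l * (F l j - (\<Sum>m\<in>I. E l m * F m j)))" for j
  proof -
    have "(\<Sum>l\<in>I. z l * F l j) = (\<Sum>l\<in>I. w l * F l j) - (\<Sum>l\<in>I. \<Sum>i\<in>I. w i * E i l * F l j)"
      by (simp add: z_def left_diff_distrib sum_subtractf sum_distrib_right)
    also have "(\<Sum>l\<in>I. \<Sum>i\<in>I. w i * E i l * F l j) = (\<Sum>i\<in>I. w i * (\<Sum>l\<in>I. E i l * F l j))"
      by (subst sum.swap) (simp add: sum_distrib_left mult.assoc)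
    finally show ?thesis by (simp add: right_diff_distrib sum_subtractf)
  qed
  have "(\<Sum>l\<in>I. (\<Sum>k\<in>insert q J. F i k * T' k l) * F l j) = F i j"
    if i: "i \<in> I" and j: "j \<in> insert q J" for i j
  proof -
    have "(\<Sum>l\<in>I. (\<Sum>k\<in>insert q J. F i k * T' k l) * F l j) =
        (\<Sum>l\<in>I. E i l * F l j) + u i * (\<Sum>l\<in>I. z l * F l j)"
      by (simp add: FT distrib_right sum.distrib sum_distrib_left mult.assoc)
    also have "\<dots> = F i j"
    proof (cases "j = q")
      case True
      have "(\<Sum>l\<in>I. z l * F l q) = (\<Sum>l\<in>I. w l * u l)" by (simp add: zF u_def)
      then have "u i * (\<Sum>l\<in>I. z l * F l j) = u i" using w[OF i] True by simp
      then show ?thesis using True by (simp add: u_def)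
    next
      case False
      then have EF: "(\<Sum>m\<in>I. E l m * F m j) = F l j" if "l \<in> I" for l
        using T[OF that, of j] j by (simp add: E_def)
      then have "(\<Sum>l\<in>I. z l * F l j) = 0" unfolding zF by (intro sum.neutral) simp
      then show ?thesis using EF[OF i] by simp
    qed
    finally show ?thesis .
  qed
  then show ?case by blast
qed

text \<open>Natural multiples of 1 are central, hence so is the inverse of one; this lets the
  averaging factor move past ring elements.\<close>

lemma ring_invertible_of_nat:
  fixes m :: nat
  assumes "ring_invertible (of_nat m :: 'r::ring_1)"
  obtains v :: "'r::ring_1" where "v * of_nat m = 1" "\<And>r. v * r = r * v"
proof -
  obtain v :: 'r where v: "of_nat m * v = 1" "v * of_nat m = 1"
    using assms unfolding ring_invertible_def by blast
  have "v * r = r * v" for r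
  proof -
    have "v * r = v * (r * of_nat m) * v" using v(1) by (simp add: mult.assoc)
    also have "r * of_nat m = of_nat m * r" by (metis mult_of_nat_commute)
    also have "v * (of_nat m * r) * v = r * v" using v(2) by (simp flip: mult.assoc)
    finally show ?thesis .
  qed
  then show ?thesis using that v(2) by blast
qed

section \<open>Regularity over a single finite orbit\<close>

context groupoid
begin

lemma subgroupoid_rng: "subgroupoid G H \<Longrightarrow> h \<in> H \<Longrightarrow> rng G h \<in> H"
  unfolding subgroupoid_def by (metis cmp_ginv_right rng_ginv)

lemma subgroupoid_ginv: "subgroupoid G H \<Longrightarrow> h \<in> H \<Longrightarrow> ginv G h \<in> H"
  unfolding subgroupoid_def by blast

lemma subgroupoid_cmp:
  "subgroupoid G H \<Longrightarrow> h \<in> H \<Longrightarrow> k \<in> H \<Longrightarrow> src G h = rng G k \<Longrightarrow> cmp G h k \<in> H"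
  unfolding subgroupoid_def by blast

lemma subgroup_subgroupoid_isotropy:
  assumes H: "subgroupoid G H" and x: "x \<in> H" "x \<in> units_of_groupoid G"
  shows "subgroup {h \<in> H. src G h = x \<and> rng G h = x} (isotropy_group G x)"
proof
  fix h assume h: "h \<in> {h \<in> H. src G h = x \<and> rng G h = x}"
  then have "h \<in> carrier (isotropy_group G x)" by (auto simp: isotropy_group_def)
  from inv_isotropy_group[OF x(2) this] show "inv\<^bsub>isotropy_group G x\<^esub> h \<in> {h \<in> H. src G h = x \<and> rng G h = x}"
    using h H by (auto simp: gsimps subgroupoid_ginv)
qed (use H x unit_iff[of x] unit_iff'[of x] in
    \<open>auto simp: isotropy_group_def gsimps subgroupoid_cmp\<close>)

lemma convolution_support:
  assumes H: "subgroupoid G H" and f: "\<And>a. f a \<noteq> 0 \<Longrightarrow> a \<in> H" and h: "\<And>a. h a \<noteq> 0 \<Longrightarrow> a \<in> H"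
    and "convolution G f h x \<noteq> 0"
  shows "x \<in> H"
proof -
  have "\<exists>a b. (a, b) \<in> composable G \<and> cmp G a b = x \<and> f a * h b \<noteq> 0"
  proof (rule ccontr)
    assume "\<not> ?thesis"
    then have *: "{(a, b). (a, b) \<in> composable G \<and> cmp G a b = x \<and> f a * h b \<noteq> 0} = {}" by blast
    have "convolution G f h x = 0" unfolding convolution_def * by (rule sum.empty)
    then show False using assms(4) by simp
  qed
  then obtain a b where "src G a = rng G b" "cmp G a b = x" "f a * h b \<noteq> 0"
    unfolding composable_def by blast
  moreover from this have "f a \<noteq> 0" "h b \<noteq> 0" by auto
  ultimately show ?thesis using f h subgroupoid_cmp[OF H] by blast
qed

text \<open>
  The functions on the orbit of \<open>x\<close> act on the free module over the arrows out of \<open>x\<close>, i.e. they embed in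
  a matrix ring.  Averaging a matrix \<open>T\<close> over the right action of the isotropy group of \<open>x\<close> (the sum
  over \<open>h\<close> below) is a bimodule retraction of the matrices onto these functions, as in Maschke's theorem.
\<close>

lemma finite_orbit_regular:
  fixes f b :: "'g \<Rightarrow> 'r::ring_1"
  assumes H: "subgroupoid G H" and f: "\<And>a. f a \<noteq> 0 \<Longrightarrow> a \<in> H"
    and X: "X = {h \<in> H. src G h = x}" "finite X"
    and v: "v * of_nat (card {h \<in> H. src G h = x \<and> rng G h = x}) = 1" "\<And>r. v * r = r * v"
    and T: "\<And>i j. i \<in> X \<Longrightarrow> j \<in> X \<Longrightarrow>
      (\<Sum>l\<in>X. (\<Sum>k\<in>X. f (cmp G i (ginv G k)) * T k l) * f (cmp G l (ginv G j))) = f (cmp G i (ginv G j))"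
    and b0: "\<And>a. b a \<noteq> 0 \<Longrightarrow> a \<in> H"
    and b: "\<And>a. a \<in> H \<Longrightarrow> rng G a \<in> rng G ` X \<Longrightarrow>
      b a = v * (\<Sum>h | h \<in> X \<and> rng G h = src G a. T (cmp G a h) h)"
    and c: "c \<in> H" "rng G c \<in> rng G ` X"
  shows "convolution G (convolution G f b) f c = f c"
proof -
  note Hsimps = subgroupoid_cmp[OF H] subgroupoid_ginv[OF H]
  have XH: "h \<in> H" "src G h = x" if "h \<in> X" for h using that by (auto simp: X)
  define L where "L y = {a \<in> H. src G a = y}" for y
  have orbit: "src G a \<in> rng G ` X \<longleftrightarrow> rng G a \<in> rng G ` X" if "a \<in> H" for a
  proof
    assume "src G a \<in> rng G ` X"
    then obtain k where "k \<in> X" "src G a = rng G k" by blast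
    then show "rng G a \<in> rng G ` X" using that
      by (intro image_eqI[of _ _ "cmp G a k"]) (auto simp: X gsimps Hsimps)
  next
    assume "rng G a \<in> rng G ` X"
    then obtain k where "k \<in> X" "rng G a = rng G k" by blast
    then show "src G a \<in> rng G ` X" using that
      by (intro image_eqI[of _ _ "cmp G (ginv G a) k"]) (auto simp: X gsimps Hsimps)
  qed
  \<comment> \<open>Right translation by \<open>k\<close> turns arrows leaving
    \<open>rng G k\<close> into arrows leaving \<open>x\<close>; this makes \<open>X\<close> the
    common index set for rows and columns.\<close>
  have L: "bij_betw (\<lambda>a. cmp G a k) (L (rng G k)) X" if "k \<in> X" for k
    by (rule bij_betw_byWitness[where f' = "\<lambda>a. cmp G a (ginv G k)"])
      (use that in \<open>auto simp: L_def X gsimps Hsimps\<close>)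
  have finL: "finite (L y)" if "y \<in> rng G ` X" for y
    using that bij_betw_finite[OF L] X(2) by blast
  have fb: "convolution G f b a = (\<Sum>d\<in>L (src G a). f (cmp G a (ginv G d)) * b d)"
    if "src G a \<in> rng G ` X" for a
  proof (rule convolution_eq_right[OF finL[OF that]])
    fix d assume d: "src G d = src G a" "f (cmp G a (ginv G d)) * b d \<noteq> 0"
    then have "b d \<noteq> 0" by auto
    then show "d \<in> L (src G a)" using b0 d(1) by (simp add: L_def)
  qed (simp add: L_def)
  let ?y = "src G c"
  let ?Y = "{h \<in> X. rng G h = ?y}"
  have y: "?y \<in> rng G ` X" using orbit[OF c(1)] c(2) by simp
  \<comment> \<open>The summand of the identity for \<open>T\<close> in row \<open>cmp G c h\<close>
    and column \<open>h\<close>.\<close>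
  let ?t = "\<lambda>h l k. f (cmp G (cmp G c h) (ginv G k)) * T k l * f (cmp G l (ginv G h))"
  have "convolution G (convolution G f b) f c =
      (\<Sum>d\<in>L ?y. convolution G f b (cmp G c (ginv G d)) * f d)"
  proof (rule convolution_eq_right[OF finL[OF y]])
    fix d assume d: "src G d = src G c" "convolution G f b (cmp G c (ginv G d)) * f d \<noteq> 0"
    then have "f d \<noteq> 0" by auto
    then show "d \<in> L ?y" using f d(1) by (simp add: L_def)
  qed (simp add: L_def)
  also have "\<dots> = (\<Sum>d\<in>L ?y. \<Sum>l | l \<in> X \<and> rng G l = rng G d. \<Sum>k\<in>X.
      v * ?t (cmp G (ginv G d) l) l k)"
  proof (rule sum.cong[OF refl])
    fix d assume d: "d \<in> L ?y"
    then have dH: "d \<in> H" "src G d = ?y" by (auto simp: L_def)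
    have rd: "rng G d \<in> rng G ` X" using orbit[OF dH(1)] dH(2) y by simp
    let ?Z = "{l. l \<in> X \<and> rng G l = rng G d}"
    have finZ: "finite ?Z" using X(2) by simp
    have "convolution G f b (cmp G c (ginv G d)) * f d =
        (\<Sum>a\<in>L (rng G d). f (cmp G (cmp G c (ginv G d)) (ginv G a)) * b a) * f d"
      using dH rd by (subst fb) (auto simp: gsimps)
    also have "\<dots> = (\<Sum>a\<in>L (rng G d). \<Sum>l\<in>?Z.
        v * (f (cmp G (cmp G c (ginv G d)) (ginv G a)) * T (cmp G a l) l * f d))"
      unfolding sum_distrib_right
    proof (rule sum.cong[OF refl])
      fix a assume a: "a \<in> L (rng G d)"
      then have aH: "a \<in> H" "src G a = rng G d" by (auto simp: L_def)
      have "b a = v * (\<Sum>l\<in>?Z. T (cmp G a l) l)"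
        using b[OF aH(1)] orbit[OF aH(1)] aH(2) rd by simp
      moreover have "p * (v * q) * r = v * (p * q * r)" for p q r
        using v(2)[of p] by (metis mult.assoc)
      ultimately show "f (cmp G (cmp G c (ginv G d)) (ginv G a)) * b a * f d =
          (\<Sum>l\<in>?Z. v * (f (cmp G (cmp G c (ginv G d)) (ginv G a)) * T (cmp G a l) l * f d))"
        by (simp add: sum_distrib_left sum_distrib_right)
    qed
    also have "\<dots> = (\<Sum>l\<in>?Z. \<Sum>a\<in>L (rng G d).
        v * (f (cmp G (cmp G c (ginv G d)) (ginv G a)) * T (cmp G a l) l * f d))"
      by (rule sum.swap)
    also have "\<dots> = (\<Sum>l\<in>?Z. \<Sum>k\<in>X. v * ?t (cmp G (ginv G d) l) l k)"
    proof (rule sum.cong[OF refl])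
      fix l assume l: "l \<in> ?Z"
      then have lX: "l \<in> X" "rng G l = rng G d" by auto
      have "(\<Sum>k\<in>X. v * ?t (cmp G (ginv G d) l) l k) =
          (\<Sum>a\<in>L (rng G l). v * ?t (cmp G (ginv G d) l) l (cmp G a l))"
        by (rule sum.reindex_bij_betw[OF L[OF lX(1)], symmetric])
      also have "\<dots> = (\<Sum>a\<in>L (rng G d).
          v * (f (cmp G (cmp G c (ginv G d)) (ginv G a)) * T (cmp G a l) l * f d))"
        unfolding lX(2)
        by (rule sum.cong[OF refl]) (use lX dH in \<open>auto simp: L_def gsimps\<close>)
      finally show "(\<Sum>a\<in>L (rng G d).
          v * (f (cmp G (cmp G c (ginv G d)) (ginv G a)) * T (cmp G a l) l * f d)) =
          (\<Sum>k\<in>X. v * ?t (cmp G (ginv G d) l) l k)" by simp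
    qed
    finally show "convolution G f b (cmp G c (ginv G d)) * f d =
        (\<Sum>l\<in>?Z. \<Sum>k\<in>X. v * ?t (cmp G (ginv G d) l) l k)" .
  qed
  \<comment> \<open>The substitution \<open>h = cmp G (ginv G d) l\<close> replaces
    \<open>d\<close>. Afterwards \<open>l\<close> ranges over all of \<open>X\<close> independently
    of \<open>h\<close>, as in a matrix product.\<close>
  also have "\<dots> = (\<Sum>h\<in>?Y. \<Sum>l\<in>X. \<Sum>k\<in>X. v * ?t h l k)"
  proof -
    have "(\<Sum>d\<in>L ?y. \<Sum>l | l \<in> X \<and> rng G l = rng G d. \<Sum>k\<in>X. v * ?t (cmp G (ginv G d) l) l k) =
        (\<Sum>(d, l)\<in>Sigma (L ?y) (\<lambda>d. {l. l \<in> X \<and> rng G l = rng G d}).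
          \<Sum>k\<in>X. v * ?t (cmp G (ginv G d) l) l k)"
      by (rule sum.Sigma) (use finL[OF y] X(2) in auto)
    also have "\<dots> = (\<Sum>(h, l)\<in>?Y \<times> X. \<Sum>k\<in>X. v * ?t h l k)"
      by (rule sum.reindex_bij_witness[where i = "\<lambda>(h, l). (cmp G l (ginv G h), l)"
            and j = "\<lambda>(d, l). (cmp G (ginv G d) l, l)"])
        (auto simp: L_def X gsimps Hsimps)
    also have "\<dots> = (\<Sum>h\<in>?Y. \<Sum>l\<in>X. \<Sum>k\<in>X. v * ?t h l k)"
      by (rule sum.cartesian_product[symmetric])
    finally show ?thesis .
  qed
  also have "\<dots> = (\<Sum>h\<in>?Y. v * f c)"
  proof (rule sum.cong[OF refl])
    fix h assume h: "h \<in> ?Y"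
    then have "cmp G c h \<in> X" using c(1) by (auto simp: X gsimps Hsimps)
    then have "(\<Sum>l\<in>X. (\<Sum>k\<in>X. f (cmp G (cmp G c h) (ginv G k)) * T k l) * f (cmp G l (ginv G h))) =
        f (cmp G (cmp G c h) (ginv G h))" using h by (intro T) auto
    moreover have "cmp G (cmp G c h) (ginv G h) = c" using h by (auto simp: gsimps)
    ultimately show "(\<Sum>l\<in>X. \<Sum>k\<in>X. v * ?t h l k) = v * f c"
      by (simp add: sum_distrib_right flip: sum_distrib_left)
  qed
  also have "\<dots> = v * of_nat (card ?Y) * f c"
    by (simp add: v(2) mult.assoc)
  \<comment> \<open>The set \<open>?Y\<close> is a coset of the isotropy group at \<open>x\<close>,
    so the factor \<open>v\<close> cancels the number of summands.\<close>
  also have "card ?Y = card {h \<in> H. src G h = x \<and> rng G h = x}"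
  proof -
    obtain k where k: "k \<in> X" "rng G k = ?y" using y by (metis imageE)
    have "bij_betw (\<lambda>h. cmp G (ginv G k) h) ?Y {h \<in> H. src G h = x \<and> rng G h = x}"
      by (rule bij_betw_byWitness[where f' = "\<lambda>h. cmp G k h"])
        (use k in \<open>auto simp: X gsimps Hsimps\<close>)
    then show ?thesis by (rule bij_betw_same_card)
  qed
  finally show ?thesis using v(1) by simp
qed

end

section \<open>From orbits to the whole unit space\<close>

context ample_groupoid
begin

text \<open>Finitely many bisections cover \<open>C\<close>, and each contains at most one arrow
  with a given source.\<close>

lemma compact_src_fibre_finite:
  assumes "compact C" shows "finite {a \<in> C. src G a = x}"
proof -
  obtain \<U> where \<U>: "finite \<U>" "\<U> \<subseteq> compact_bisections G" "C \<subseteq> \<Union>\<U>"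
    using compact_cover_bisections[OF assms open_UNIV] by auto
  have "finite {a \<in> U. src G a = x}" if "U \<in> \<U>" for U
  proof -
    have inj: "inj_on (src G) U" using \<U>(2) that by (auto simp: compact_bisections_iff)
    have "inj_on (src G) {a \<in> U. src G a = x}" using inj by (rule inj_on_subset) auto
    moreover have "finite (src G ` {a \<in> U. src G a = x})"
      by (rule finite_subset[of _ "{x}"]) auto
    ultimately show ?thesis using finite_imageD by blast
  qed
  then have "finite (\<Union>U\<in>\<U>. {a \<in> U. src G a = x})" using \<U>(1) by blast
  then show ?thesis by (rule rev_finite_subset) (use \<U>(3) in auto)
qed

text \<open>A quasi-inverse over the orbit of \<open>x\<close> is extended along bisections to an
  element \<open>b\<close> of the algebra. The germ lemma, applied to the defect \<open>g\<close> at
  each point of the orbit, spreads the identity to a neighbourhood, inside which an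
  \<open>H\<close>-invariant one is found.\<close>

lemma orbit_local_inverse:
  fixes f :: "'a \<Rightarrow> 'r::ring_1"
  assumes R: "von_neumann_regular (UNIV :: 'r set) (*)"
    and H: "subgroupoid G H" "open H" "compact H"
    and f: "f \<in> groupoid_algebra G" "\<And>a. f a \<noteq> 0 \<Longrightarrow> a \<in> H"
    and x: "x \<in> H" "x \<in> units_of_groupoid G"
    and card: "ring_invertible (of_nat (card {h \<in> H. src G h = x \<and> rng G h = x}) :: 'r)"
  shows "\<exists>b\<in>groupoid_algebra G. \<exists>S. open S \<and> compact S \<and> S \<subseteq> units_of_groupoid G \<and> x \<in> S \<and>
    (\<forall>h\<in>H. src G h \<in> S \<longleftrightarrow> rng G h \<in> S) \<and>
    (\<forall>a. rng G a \<in> S \<longrightarrow> convolution G (convolution G f b) f a = f a)"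
proof -
  note Hsimps = subgroupoid_cmp[OF H(1)] subgroupoid_ginv[OF H(1)]
  have xs: "src G x = x" "rng G x = x" using x(2) unit_iff unit_iff' by auto
  define X where "X = {h \<in> H. src G h = x}"
  have finX: "finite X" unfolding X_def by (rule compact_src_fibre_finite[OF H(3)])
  define Or where "Or = rng G ` X"
  have finO: "finite Or" and Ou: "Or \<subseteq> units_of_groupoid G" using finX by (auto simp: Or_def)
  define HO where "HO = {h \<in> H. rng G h \<in> Or}"
  have finHO: "finite HO"
  proof -
    have "HO \<subseteq> (\<Union>y\<in>Or. ginv G ` {a \<in> H. src G a = y})"
    proof
      fix h assume "h \<in> HO"
      then have "ginv G h \<in> {a \<in> H. src G a = rng G h}" "rng G h \<in> Or"
        by (auto simp: HO_def gsimps Hsimps)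
      then show "h \<in> (\<Union>y\<in>Or. ginv G ` {a \<in> H. src G a = y})"
        by (intro UN_I[of "rng G h"] image_eqI[of _ _ "ginv G h"]) (simp_all add: ginv_ginv)
    qed
    then show ?thesis
      by (rule finite_subset) (use finO compact_src_fibre_finite[OF H(3)] in auto)
  qed
  obtain T where T: "\<And>i j. i \<in> X \<Longrightarrow> j \<in> X \<Longrightarrow>
      (\<Sum>l\<in>X. (\<Sum>k\<in>X. f (cmp G i (ginv G k)) * T k l) * f (cmp G l (ginv G j))) = f (cmp G i (ginv G j))"
    using matrix_regular[OF R finX finX, of "\<lambda>i j. f (cmp G i (ginv G j))"] by blast
  obtain v :: 'r where v: "v * of_nat (card {h \<in> H. src G h = x \<and> rng G h = x}) = 1"
    "\<And>r. v * r = r * v"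
    by (rule ring_invertible_of_nat[OF card]) blast
  define b0 where "b0 a = v * (\<Sum>h | h \<in> X \<and> rng G h = src G a. T (cmp G a h) h)" for a
  \<comment> \<open>Keeping the ranges away from the other points of the finite orbit, together with
    injectivity of the range map, leaves \<open>a\<close> as the only arrow of \<open>HO\<close> in
    \<open>U\<close>. Hence \<open>b\<close> below takes exactly the values of \<open>b0\<close> on
    \<open>HO\<close>.\<close>
  have "\<exists>U. U \<in> compact_bisections G \<and> a \<in> U \<and> U \<subseteq> H \<and> U \<inter> HO = {a}" if a: "a \<in> HO" for a
  proof -
    let ?D = "units_of_groupoid G - (Or - {rng G a})"
    have "open ?D"
      using finO Ou by (intro open_units_diff_compact finite_imp_compact) auto
    then have "open (H \<inter> rng G -` ?D)" by (simp add: H(2) open_Int open_vimage_rng)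
    moreover have "a \<in> H \<inter> rng G -` ?D" using a by (auto simp: HO_def)
    ultimately obtain U where U: "U \<in> compact_bisections G" "a \<in> U" "U \<subseteq> H \<inter> rng G -` ?D"
      by (rule compact_bisections_basis)
    have "d = a" if "d \<in> U" "d \<in> HO" for d
    proof -
      have "rng G d = rng G a" using that U(3) by (auto simp: HO_def)
      then show ?thesis using U(1,2) that(1) by (auto simp: compact_bisections_iff inj_on_def)
    qed
    then show ?thesis using U a by blast
  qed
  then obtain U where U: "\<And>a. a \<in> HO \<Longrightarrow> U a \<in> compact_bisections G" "\<And>a. a \<in> HO \<Longrightarrow> U a \<subseteq> H"
    "\<And>a. a \<in> HO \<Longrightarrow> U a \<inter> HO = {a}"
    by metis
  define b where "b = (\<lambda>d. \<Sum>a\<in>HO. b0 a * indicator (U a) d)"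
  have bGA: "b \<in> groupoid_algebra G"
    unfolding b_def by (intro groupoid_algebra_sum finHO groupoid_algebra_indicator U(1))
  have bH: "a \<in> H" if "b a \<noteq> 0" for a
  proof (rule ccontr)
    assume "a \<notin> H"
    then have "b a = 0" unfolding b_def using U(2) by (intro sum.neutral) (auto split: split_indicator)
    then show False using that by simp
  qed
  have b_eq: "b a = b0 a" if a: "a \<in> HO" for a
  proof -
    have "b a = (\<Sum>d\<in>HO. if d = a then b0 d else 0)"
      unfolding b_def
    proof (rule sum.cong[OF refl])
      fix d assume d: "d \<in> HO"
      have "a \<in> U d \<longleftrightarrow> d = a" using U(3)[OF d] a by (metis IntD1 IntI singletonD singletonI)
      then show "b0 d * indicator (U d) a = (if d = a then b0 d else 0)"
        by (cases "d = a") auto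
    qed
    then show ?thesis using finHO a by simp
  qed
  let ?fbf = "convolution G (convolution G f b) f"
  \<comment> \<open>Arrows outside \<open>H\<close> are harmless: \<open>f\<close> and
    \<open>b\<close> are supported in the subgroupoid \<open>H\<close>, so both sides vanish
    there.\<close>
  have on_orbit: "?fbf a = f a" if "rng G a \<in> Or" for a
  proof (cases "a \<in> H")
    case True
    show ?thesis
      by (rule finite_orbit_regular[OF H(1) f(2) X_def finX v T bH _ True])
        (use b_eq that in \<open>auto simp: HO_def b0_def Or_def\<close>)
  next
    case False
    have "c \<in> H" if "convolution G f b c \<noteq> 0" for c
      using convolution_support[OF H(1) f(2) bH that] by simp
    from convolution_support[OF H(1) this f(2), where x = a] show ?thesis
      using False f(2) by fastforce
  qed
  define g where "g = (\<lambda>a. ?fbf a - f a)"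
  have gGA: "g \<in> groupoid_algebra G"
    unfolding g_def by (intro groupoid_algebra_diff groupoid_algebra_convolution f(1) bGA)
  have "\<exists>V. open V \<and> y \<in> V \<and> (\<forall>a. rng G a \<in> V \<longrightarrow> g a = 0)" if "y \<in> Or" for y
    by (rule groupoid_algebra_germ_zero[OF gGA]) (use that Ou on_orbit in \<open>auto simp: g_def\<close>)
  then obtain V where V: "\<And>y. y \<in> Or \<Longrightarrow> open (V y)" "\<And>y. y \<in> Or \<Longrightarrow> y \<in> V y"
    "\<And>y a. y \<in> Or \<Longrightarrow> rng G a \<in> V y \<Longrightarrow> g a = 0"
    by metis
  define VO where "VO = (\<Union>y\<in>Or. V y)"
  have oVO: "open VO" using V(1) by (auto simp: VO_def)
  \<comment> \<open>The units from which some arrow of \<open>H\<close> leaves \<open>VO\<close>.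
    This set is compact and misses \<open>x\<close>, since arrows of \<open>H\<close> starting at
    \<open>x\<close> end in the orbit.\<close>
  define B where "B = src G ` (H - rng G -` VO)"
  have "compact B" "B \<subseteq> units_of_groupoid G"
    using H(3) oVO by (auto simp: B_def intro!: compact_src_image compact_diff open_vimage_rng)
  then have "open (units_of_groupoid G - B)" by (rule open_units_diff_compact)
  moreover have "x \<in> units_of_groupoid G - B"
  proof -
    have "rng G h \<in> VO" if "h \<in> H" "src G h = x" for h
    proof -
      have "rng G h \<in> Or" using that by (auto simp: Or_def X_def)
      then show ?thesis using V(2) by (auto simp: VO_def)
    qed
    then show ?thesis using x(2) by (auto simp: B_def)
  qed
  ultimately obtain K where K: "K \<in> compact_bisections G" "x \<in> K" "K \<subseteq> units_of_groupoid G - B"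
    by (rule compact_bisections_basis)
  have K': "open K" "compact K" using K(1) by (auto simp: compact_bisections_iff)
  \<comment> \<open>The saturation of \<open>K\<close> under \<open>H\<close>, which makes it
    invariant. It stays inside \<open>VO\<close> because \<open>K\<close> avoids
    \<open>B\<close>.\<close>
  define S where "S = rng G ` (H \<inter> src G -` K)"
  have "open S" unfolding S_def
    by (intro open_rng_image open_Int H(2) open_vimage_src K'(1))
  moreover have "compact S"
  proof -
    have "open (units_of_groupoid G - K)" using K K'(2) by (intro open_units_diff_compact) auto
    then have "compact (H - src G -` (units_of_groupoid G - K))"
      by (intro compact_diff H(3) open_vimage_src)
    also have "H - src G -` (units_of_groupoid G - K) = H \<inter> src G -` K" by auto
    finally show ?thesis unfolding S_def by (rule compact_rng_image)
  qed
  moreover have "S \<subseteq> units_of_groupoid G" by (auto simp: S_def)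
  moreover have "x \<in> S" unfolding S_def using x xs K(2) by (intro image_eqI[of _ _ x]) auto
  moreover have "src G h \<in> S \<longleftrightarrow> rng G h \<in> S" if h: "h \<in> H" for h
  proof
    assume "src G h \<in> S"
    then obtain k where "k \<in> H" "src G k \<in> K" "src G h = rng G k" by (auto simp: S_def)
    then show "rng G h \<in> S" unfolding S_def using h
      by (intro image_eqI[of _ _ "cmp G h k"]) (auto simp: gsimps Hsimps)
  next
    assume "rng G h \<in> S"
    then obtain k where "k \<in> H" "src G k \<in> K" "rng G h = rng G k" by (auto simp: S_def)
    then show "src G h \<in> S" unfolding S_def using h
      by (intro image_eqI[of _ _ "cmp G (ginv G h) k"]) (auto simp: gsimps Hsimps)
  qed
  moreover have "?fbf a = f a" if aS: "rng G a \<in> S" for a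
  proof -
    obtain h where h: "h \<in> H" "src G h \<in> K" "rng G a = rng G h" using aS by (auto simp: S_def)
    have "rng G h \<in> VO"
    proof (rule ccontr)
      assume "rng G h \<notin> VO"
      then have "src G h \<in> B" using h(1) by (auto simp: B_def)
      then show False using h(2) K(3) by blast
    qed
    then have "g a = 0" using V(3) h(3) by (auto simp: VO_def)
    then show ?thesis by (simp add: g_def)
  qed
  ultimately show ?thesis using bGA by blast
qed

text \<open>The quasi-inverse \<open>b\<close> may vary with \<open>S\<close>; invariance of
  \<open>S\<close> under \<open>H\<close> is what allows different choices to be glued.\<close>

definition locally_invertible_on :: "('a \<Rightarrow> 'r::ring_1) \<Rightarrow> 'a set \<Rightarrow> 'a set \<Rightarrow> bool" where
  "locally_invertible_on f H S \<longleftrightarrow> open S \<and> compact S \<and> S \<subseteq> units_of_groupoid G \<and>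
    (\<forall>h\<in>H. src G h \<in> S \<longleftrightarrow> rng G h \<in> S) \<and>
    (\<exists>b\<in>groupoid_algebra G. \<forall>a. rng G a \<in> S \<longrightarrow> convolution G (convolution G f b) f a = f a)"

text \<open>The function \<open>d\<close> uses \<open>b'\<close> over ranges in \<open>S'\<close>
  and \<open>b\<close> elsewhere. Arrows supporting \<open>f\<close> do not cross the boundary of
  the invariant set \<open>S'\<close>, so the two choices never mix in a convolution with
  \<open>f\<close>.\<close>

lemma locally_invertible_on_Un:
  assumes f: "f \<in> groupoid_algebra G" "\<And>a. f a \<noteq> 0 \<Longrightarrow> a \<in> H"
    and S: "locally_invertible_on f H S" and S': "locally_invertible_on f H S'"
  shows "locally_invertible_on f H (S \<union> S')"
proof -
  note rf = groupoid_algebra_rng_finite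
  obtain b where b: "b \<in> groupoid_algebra G"
    "\<And>a. rng G a \<in> S \<Longrightarrow> convolution G (convolution G f b) f a = f a"
    using S unfolding locally_invertible_on_def by blast
  obtain b' where b': "b' \<in> groupoid_algebra G"
    "\<And>a. rng G a \<in> S' \<Longrightarrow> convolution G (convolution G f b') f a = f a"
    using S' unfolding locally_invertible_on_def by blast
  have Scb: "S' \<in> compact_bisections G" and Su: "S' \<subseteq> units_of_groupoid G"
    and inv: "\<And>h. h \<in> H \<Longrightarrow> src G h \<in> S' \<longleftrightarrow> rng G h \<in> S'"
    using S' by (auto simp: locally_invertible_on_def intro: compact_bisections_units)
  let ?i = "\<lambda>a. 1 * indicator S' a"
  define d where "d = (\<lambda>a. b a - convolution G ?i b a + convolution G ?i b' a)"
  have dGA: "d \<in> groupoid_algebra G"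
    unfolding d_def
    by (intro groupoid_algebra_add groupoid_algebra_diff groupoid_algebra_convolution
        groupoid_algebra_indicator Scb b(1) b'(1))
  have d: "d a = (if rng G a \<in> S' then b' a else b a)" for a
    unfolding d_def convolution_unit_indicator_left[OF Su] by simp
  \<comment> \<open>The argument of \<open>d\<close> in each summand has range
    \<open>src G a\<close>, which lies in \<open>S'\<close> exactly when
    \<open>rng G a = rng G c\<close> does.\<close>
  have "convolution G f d c = convolution G f (if rng G c \<in> S' then b' else b) c" for c
    unfolding convolution_rng_finite[OF rf[OF f(1)]]
  proof (rule sum.cong[OF refl])
    fix a assume a: "a \<in> {a. rng G a = rng G c \<and> f a \<noteq> 0}"
    then show "f a * d (cmp G (ginv G a) c) = f a * (if rng G c \<in> S' then b' else b) (cmp G (ginv G a) c)"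
      using inv[OF f(2)[of a]] by (simp add: d gsimps)
  qed
  then have "convolution G (convolution G f d) f a =
      convolution G (convolution G f (if rng G a \<in> S' then b' else b)) f a" for a
    by (intro convolution_cong_left) simp
  then have "convolution G (convolution G f d) f a = f a" if "rng G a \<in> S \<union> S'" for a
    using that b(2)[of a] b'(2)[of a] by auto
  then show ?thesis
    using S S' dGA unfolding locally_invertible_on_def by (auto simp: open_Un compact_Un)
qed

lemma groupoid_algebra_regular:
  assumes R: "von_neumann_regular (UNIV :: 'r::ring_1 set) (*)"
    and du: "directed_union_of (\<lambda>H. subgroupoid G H \<and> open H \<and> compact H) UNIV"
    and inv: "\<forall>x\<in>units_of_groupoid G. \<forall>H. subgroup H (isotropy_group G x) \<and> finite H \<longrightarrow>
      ring_invertible (of_nat (card H) :: 'r)"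
  shows "von_neumann_regular (groupoid_algebra G :: ('a \<Rightarrow> 'r) set) (convolution G)"
  unfolding von_neumann_regular_def
proof
  fix f :: "'a \<Rightarrow> 'r" assume f: "f \<in> groupoid_algebra G"
  obtain \<D> where \<D>: "\<D> \<noteq> {}" "\<And>H. H \<in> \<D> \<Longrightarrow> subgroupoid G H \<and> open H \<and> compact H"
    "\<And>H K. H \<in> \<D> \<Longrightarrow> K \<in> \<D> \<Longrightarrow> \<exists>L\<in>\<D>. H \<subseteq> L \<and> K \<subseteq> L" "\<Union>\<D> = UNIV"
    using du unfolding directed_union_of_def by metis
  obtain C where C: "compact C" "\<And>a. f a \<noteq> 0 \<Longrightarrow> a \<in> C"
    using groupoid_algebra_compact_support[OF f] by blast
  obtain \<F> where \<F>: "\<F> \<subseteq> \<D>" "finite \<F>" "C \<subseteq> \<Union>\<F>"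
    by (rule compactE[OF C(1), of \<D>]) (use \<D>(2,4) in auto)
  \<comment> \<open>Directedness absorbs the finite subcover into a single member of the
    family.\<close>
  have "\<exists>H\<in>\<D>. \<Union>\<F> \<subseteq> H" using \<F>(2,1)
  proof (induction \<F> rule: finite_induct)
    case empty
    then show ?case using \<D>(1) by auto
  next
    case (insert K \<F>)
    then obtain H where "H \<in> \<D>" "\<Union>\<F> \<subseteq> H" by auto
    moreover from this obtain L where "L \<in> \<D>" "K \<subseteq> L" "H \<subseteq> L"
      using \<D>(3)[of K H] insert.prems by auto
    ultimately show ?case by (intro bexI[of _ L]) auto
  qed
  then obtain H where HD: "H \<in> \<D>" "\<Union>\<F> \<subseteq> H" by (rule bexE)
  then have H: "subgroupoid G H" "open H" "compact H" using \<D>(2) by auto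
  have fH: "a \<in> H" if "f a \<noteq> 0" for a using C(2)[OF that] \<F>(3) HD(2) by (meson subsetD)
  have "\<exists>S. x \<in> S \<and> locally_invertible_on f H S" if "x \<in> rng G ` H" for x
  proof -
    have x: "x \<in> H" "x \<in> units_of_groupoid G" using that subgroupoid_rng[OF H(1)] by auto
    let ?K = "{h \<in> H. src G h = x \<and> rng G h = x}"
    have "finite ?K"
      by (rule finite_subset[OF _ compact_src_fibre_finite[OF H(3), of x]]) auto
    then have "ring_invertible (of_nat (card ?K) :: 'r)"
      using inv x(2) subgroup_subgroupoid_isotropy[OF H(1) x] by blast
    from orbit_local_inverse[OF R H f fH x this] show ?thesis
      unfolding locally_invertible_on_def by blast
  qed
  then obtain S where S: "\<And>x. x \<in> rng G ` H \<Longrightarrow> x \<in> S x \<and> locally_invertible_on f H (S x)"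
    by metis
  obtain \<T> where \<T>: "\<T> \<subseteq> S ` rng G ` H" "finite \<T>" "rng G ` H \<subseteq> \<Union>\<T>"
    by (rule compactE[OF compact_rng_image[OF H(3)], of "S ` rng G ` H"])
      (use S in \<open>auto simp: locally_invertible_on_def\<close>)
  have "locally_invertible_on f H (\<Union>\<T>)" using \<T>(2,1)
  proof (induction \<T> rule: finite_induct)
    case empty
    show ?case using groupoid_algebra_zero by (auto simp: locally_invertible_on_def)
  next
    case (insert T \<T>)
    then have "locally_invertible_on f H T" using S by auto
    then show ?case using locally_invertible_on_Un[OF f fH] insert by simp
  qed
  then obtain b where b: "b \<in> groupoid_algebra G"
    "\<And>a. rng G a \<in> \<Union>\<T> \<Longrightarrow> convolution G (convolution G f b) f a = f a"
    unfolding locally_invertible_on_def by (elim conjE bexE) (rule that, assumption, simp)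
  have "convolution G (convolution G f b) f a = f a" for a
  proof (cases "rng G a \<in> rng G ` H")
    case True
    then show ?thesis using \<T>(3) b(2) by blast
  next
    \<comment> \<open>Over a unit that is not the range of an arrow of \<open>H\<close>, the
      function \<open>f\<close> vanishes, and so does any convolution with \<open>f\<close> as left
      factor.\<close>
    case False
    have f0: "f c = 0" if "rng G c = rng G a" for c
      using False that fH by (metis imageI)
    have zero: "convolution G (\<lambda>_. 0 :: 'r) h c = 0" for h c
      by (simp add: convolution_rng_finite rng_finite_zero)
    have "convolution G f b c = 0" if "rng G c = rng G a" for c
      using convolution_cong_left[of c f "\<lambda>_. 0" b] f0 that zero by simp
    then have "convolution G (convolution G f b) f a = 0"
      using convolution_cong_left[of a "convolution G f b" "\<lambda>_. 0" f] zero by simp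
    then show ?thesis using f0 by simp
  qed
  then show "\<exists>b\<in>groupoid_algebra G. convolution G (convolution G f b) f = f"
    using b(1) by blast
qed

end

theorem theoremA:
  fixes G :: "'g::topological_space groupoid_ops"
  assumes "ample_groupoid G"
  shows "von_neumann_regular (groupoid_algebra G :: ('g \<Rightarrow> 'r::ring_1) set) (convolution G) \<longleftrightarrow>
    von_neumann_regular (UNIV :: 'r set) (*) \<and>
    directed_union_of (\<lambda>H. subgroupoid G H \<and> open H \<and> compact H) UNIV \<and>
    (\<forall>x\<in>units_of_groupoid G. \<forall>H. subgroup H (isotropy_group G x) \<and> finite H \<longrightarrow>
       ring_invertible (of_nat (card H) :: 'r))"
proof -
  interpret ample_groupoid G by fact
  show ?thesis
    using coefficients_regular directed_union_of_compact_subgroupoids isotropy_order_invertible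
      groupoid_algebra_regular by blast
qed

end
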